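(* Let $\mathscr{G}_7$ be the set of all connected graphs that induce an odd cycle of length $7$ or more, but induce no $5$-cycle and no pendant graph, and let $\mathscr{G}_7^c$ be its complement in the set of connected graphs. If $G\in\mathscr{G}_7^c$ is matching-stable, then $G$ is separable of order $q$ for some $q\ge 3$.
   Context: Graphs $G=(\mathcal V,\mathcal E)$ are finite, undirected and simple. $\mathcal E(A)$ denotes the set of nodes adjacent to at least one node of $A\subset\mathcal V$, and $\mathcal E(i)=\mathcal E(\{i\})$. An independent set is a non-empty set of pairwise non-adjacent nodes; $\mathbb I(G)$ is the set of independent sets of $G$. An independent set is maximal if adding any other node destroys independence. $G$ induces a graph $H$ if $H$ is (isomorphic to) an induced subgraph of $G$. The pendant graph is the graph on $\{1,2,3,4\}$ with edges $12,13,23,34$ (a triangle with one pendant edge). Separable graph: $G$ is separable of order $q\ge2$ if $\mathcal V$ can be partitioned into maximal independent sets $\mathcal I_1,\dots,\mathcal I_q$ such that every $u\in\mathcal I_i$ is adjacent to every $v\in\mathcal I_j$ whenever $i\neq j$. Matching queue $(G,\lambda,\Phi)$: items of class $i\in\mathcal V$ arrive according to independent Poisson processes with intensities $\lambda_i>0$. An arriving class-$i$ item is matched immediately with exactly one queued item of some class in $\mathcal E(i)$ if there is one (both items then leave the system at once); otherwise it is queued. The matching policy $\Phi$ determines the class of the match when several are possible. $Q_i(t)$ is the number of queued class-$i$ items at time $t$, $Q=(Q_i)_{i\in\mathcal V}$. The policy $\Phi$ is admissible if matchings always occur when possible and decisions are made solely on the value of $Q$ at the arrival epoch (possibly using independent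 randomization); then $Q$ is a continuous-time Markov chain (CTMC) on $\{z\in\mathbb Z_+^{|\mathcal V|}: z_iz_j=0 \text{ whenever } i,j \text{ are adjacent}\}$. The matching queue is stable if $Q$ is positive recurrent, and unstable otherwise. The stability region of $(G,\Phi)$ is the set of $\lambda\in(0,\infty)^{|\mathcal V|}$ for which $(G,\lambda,\Phi)$ is stable. $\mathrm{Ncond}(G)=\{\lambda\in(0,\infty)^{|\mathcal V|}:\ \sum_{i\in\mathcal I}\lambda_i<\sum_{j\in\mathcal E(\mathcal I)}\lambda_j\ \text{for all }\mathcal I\in\mathbb I(G)\}$. An admissible policy $\Phi$ on a connected graph $G$ is maximal if the stability region of $(G,\Phi)$ equals $\mathrm{Ncond}(G)$. A connected graph $G$ is matching-stable if $\mathrm{Ncond}(G)\ne\emptyset$ and all admissible matching policies on $G$ are maximal. *)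

theory Defs
  imports
    "HOL-Probability.Probability"
    "HOL-Library.Disjoint_Sets"
    "Graph_Theory.Graph_Theory"
begin

section \<open>Graphs\<close>

text \<open>
  A finite simple undirected graph is a \<^locale>\<open>pair_graph\<close>: its arc relation is symmetric and
  irreflexive. \<^const>\<open>Digraph_Component.connected\<close> requires a nonempty vertex set. The qualified
  name distinguishes it from topological connectedness.
\<close>

definition connected_graphs :: "'v pair_pre_digraph set" where
  "connected_graphs = {G. pair_graph G \<and> Digraph_Component.connected (with_proj G)}"

definition neighbours :: "'v pair_pre_digraph \<Rightarrow> 'v set \<Rightarrow> 'v set" where
  "neighbours G A = {j. \<exists>i\<in>A. (i, j) \<in> parcs G}"

definition independent_set :: "'v pair_pre_digraph \<Rightarrow> 'v set \<Rightarrow> bool" where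
  "independent_set G I \<longleftrightarrow>
     I \<noteq> {} \<and> I \<subseteq> pverts G \<and> (\<forall>u\<in>I. \<forall>v\<in>I. (u, v) \<notin> parcs G)"

definition maximal_independent_set :: "'v pair_pre_digraph \<Rightarrow> 'v set \<Rightarrow> bool" where
  "maximal_independent_set G I \<longleftrightarrow>
     independent_set G I \<and> (\<forall>v\<in>pverts G - I. \<not> independent_set G (insert v I))"

definition separable :: "'v pair_pre_digraph \<Rightarrow> nat \<Rightarrow> bool" where
  "separable G q \<longleftrightarrow> q \<ge> 2 \<and>
     (\<exists>P. partition_on (pverts G) P \<and> card P = q \<and>
        (\<forall>I\<in>P. maximal_independent_set G I) \<and>
        (\<forall>I\<in>P. \<forall>J\<in>P. I \<noteq> J \<longrightarrow> (\<forall>u\<in>I. \<forall>v\<in>J. (u, v) \<in> parcs G)))"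

definition induces :: "'v pair_pre_digraph \<Rightarrow> 'w pair_pre_digraph \<Rightarrow> bool" where
  "induces G H \<longleftrightarrow>
     (\<exists>K :: 'v pair_pre_digraph. induced_subgraph (with_proj K) (with_proj G) \<and>
        digraph_iso (with_proj K) (with_proj H))"

definition pendant_graph :: "nat pair_pre_digraph" where
  "pendant_graph = \<lparr> pverts = {1, 2, 3, 4},
     parcs = {(1, 2), (2, 1), (1, 3), (3, 1), (2, 3), (3, 2), (3, 4), (4, 3)} \<rparr>"

text \<open>A simple graph only for \<open>n \<ge> 3\<close>.\<close>

definition cycle_graph :: "nat \<Rightarrow> nat pair_pre_digraph" where
  "cycle_graph n = \<lparr> pverts = {0..<n},
     parcs = {(i, j). i < n \<and> j < n \<and> (j = Suc i mod n \<or> i = Suc j mod n)} \<rparr>"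

definition G7 :: "'v pair_pre_digraph set" where
  "G7 = {G \<in> connected_graphs. (\<exists>n\<ge>7. odd n \<and> induces G (cycle_graph n)) \<and>
     \<not> induces G (cycle_graph 5) \<and> \<not> induces G pendant_graph}"

definition G7c :: "'v pair_pre_digraph set" where
  "G7c = connected_graphs - G7"


section \<open>Positive recurrence\<close>

text \<open>
  The first time at which the path is back in its initial state after having left it
  (infinite if there is none). The infimum is attained for right-continuous step paths.
\<close>

definition return_time :: "(real \<Rightarrow> 's) \<Rightarrow> ennreal" where
  "return_time X = Inf {ennreal t | t. X t = X 0 \<and> (\<exists>s. 0 \<le> s \<and> s < t \<and> X s \<noteq> X 0)}"

text \<open>
  \<open>X z t \<omega>\<close> is the position at time \<open>t\<close> of the chain started in \<open>z\<close>. Every state in \<open>S\<close> is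
  required to have finite mean return time.
\<close>

definition positive_recurrent ::
    "'w measure \<Rightarrow> ('s \<Rightarrow> real \<Rightarrow> 'w \<Rightarrow> 's) \<Rightarrow> 's set \<Rightarrow> bool" where
  "positive_recurrent M X S \<longleftrightarrow>
     (\<forall>z\<in>S. (\<integral>\<^sup>+\<omega>. return_time (\<lambda>t. X z t \<omega>) \<partial>M) < \<infinity>)"


section \<open>Matching queues\<close>

definition queue_states :: "'v pair_pre_digraph \<Rightarrow> ('v \<Rightarrow> nat) set" where
  "queue_states G = {z. (\<forall>i. i \<notin> pverts G \<longrightarrow> z i = 0) \<and>
     (\<forall>(i, j)\<in>parcs G. z i * z j = 0)}"

definition available :: "'v pair_pre_digraph \<Rightarrow> ('v \<Rightarrow> nat) \<Rightarrow> 'v \<Rightarrow> 'v set" where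
  "available G z i = {j \<in> neighbours G {i}. z j > 0}"

text \<open>
  A policy assigns to the queue \<open>z\<close> found by an arriving item and the class \<open>i\<close> of that item the
  distribution of the class of its match. Its value is irrelevant if no match is available.
\<close>

type_synonym 'v policy = "('v \<Rightarrow> nat) \<Rightarrow> 'v \<Rightarrow> 'v pmf"

definition admissible :: "'v pair_pre_digraph \<Rightarrow> 'v policy \<Rightarrow> bool" where
  "admissible G \<Phi> \<longleftrightarrow>
     (\<forall>z\<in>queue_states G. \<forall>i\<in>pverts G. available G z i \<noteq> {} \<longrightarrow>
        set_pmf (\<Phi> z i) \<subseteq> available G z i)"

definition arrive :: "'v pair_pre_digraph \<Rightarrow> ('v \<Rightarrow> nat) \<Rightarrow> 'v \<Rightarrow> 'v \<Rightarrow> ('v \<Rightarrow> nat)" where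
  "arrive G z i j = (if available G z i = {} then z(i := z i + 1) else z(j := z j - 1))"

text \<open>
  A sample point is a pair \<open>(x, d)\<close>, with all coordinates independent: \<open>x (i, k)\<close> is the time
  between the \<open>k\<close>-th and the \<open>(k + 1)\<close>-st arrival of class \<open>i\<close> (counting from time 0 for \<open>k = 0\<close>),
  and \<open>d (n, z, i)\<close> is the decision taken at the arrival numbered \<open>n\<close> (over all classes,
  from 0) if the queue is then \<open>z\<close> and the item has class \<open>i\<close>.
\<close>

type_synonym 'v sample = "('v \<times> nat \<Rightarrow> real) \<times> (nat \<times> ('v \<Rightarrow> nat) \<times> 'v \<Rightarrow> 'v)"

definition queue_space ::
    "'v pair_pre_digraph \<Rightarrow> ('v \<Rightarrow> real) \<Rightarrow> 'v policy \<Rightarrow> 'v sample measure" where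
  "queue_space G l \<Phi> =
     (\<Pi>\<^sub>M (i, k)\<in>pverts G \<times> UNIV. density lborel (exponential_density (l i))) \<Otimes>\<^sub>M
     (\<Pi>\<^sub>M (n, z, i)\<in>UNIV \<times> queue_states G \<times> pverts G. measure_pmf (\<Phi> z i))"

definition epoch :: "('v \<times> nat \<Rightarrow> real) \<Rightarrow> 'v \<Rightarrow> nat \<Rightarrow> real" where
  "epoch x i k = (\<Sum>m\<le>k. x (i, m))"

definition poisson_count :: "('v \<times> nat \<Rightarrow> real) \<Rightarrow> 'v \<Rightarrow> real \<Rightarrow> nat" where
  "poisson_count x i t = card {k. epoch x i k \<le> t}"

text \<open>
  \<open>class_counts G x n i\<close> is the number of class-\<open>i\<close> items among the first \<open>n\<close> arrivals, so that
  their successor has the class \<open>i\<close> minimising \<open>epoch x i (class_counts G x n i)\<close>. Almost surely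
  there are no simultaneous arrivals, and finitely many in bounded time.
\<close>

primrec class_counts :: "'v pair_pre_digraph \<Rightarrow> ('v \<times> nat \<Rightarrow> real) \<Rightarrow> nat \<Rightarrow> 'v \<Rightarrow> nat" where
  "class_counts G x 0 = (\<lambda>_. 0)"
| "class_counts G x (Suc n) =
     (let c = class_counts G x n; i = arg_min_on (\<lambda>i. epoch x i (c i)) (pverts G)
      in c(i := Suc (c i)))"

definition arrival_class :: "'v pair_pre_digraph \<Rightarrow> ('v \<times> nat \<Rightarrow> real) \<Rightarrow> nat \<Rightarrow> 'v" where
  "arrival_class G x n = arg_min_on (\<lambda>i. epoch x i (class_counts G x n i)) (pverts G)"

primrec queue_after ::
    "'v pair_pre_digraph \<Rightarrow> ('v \<Rightarrow> nat) \<Rightarrow> nat \<Rightarrow> 'v sample \<Rightarrow> ('v \<Rightarrow> nat)" where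
  "queue_after G z 0 \<omega> = z"
| "queue_after G z (Suc n) \<omega> =
     (let y = queue_after G z n \<omega>; i = arrival_class G (fst \<omega>) n
      in arrive G y i (snd \<omega> (n, y, i)))"

definition queue_process ::
    "'v pair_pre_digraph \<Rightarrow> ('v \<Rightarrow> nat) \<Rightarrow> real \<Rightarrow> 'v sample \<Rightarrow> ('v \<Rightarrow> nat)" where
  "queue_process G z t \<omega> = queue_after G z (\<Sum>i\<in>pverts G. poisson_count (fst \<omega>) i t) \<omega>"

text \<open>
  On a connected graph with at least two nodes all states of the queue communicate. On a single
  node no state is ever revisited and the queue is unstable.
\<close>

definition stable :: "'v pair_pre_digraph \<Rightarrow> ('v \<Rightarrow> real) \<Rightarrow> 'v policy \<Rightarrow> bool" where
  "stable G l \<Phi> \<longleftrightarrow>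
     positive_recurrent (queue_space G l \<Phi>) (queue_process G) (queue_states G)"

text \<open>Intensity vectors are functions that are \<open>undefined\<close> outside the vertex set.\<close>

definition stability_region :: "'v pair_pre_digraph \<Rightarrow> 'v policy \<Rightarrow> ('v \<Rightarrow> real) set" where
  "stability_region G \<Phi> = {l \<in> pverts G \<rightarrow>\<^sub>E {0<..}. stable G l \<Phi>}"

definition Ncond :: "'v pair_pre_digraph \<Rightarrow> ('v \<Rightarrow> real) set" where
  "Ncond G = {l \<in> pverts G \<rightarrow>\<^sub>E {0<..}.
     \<forall>I. independent_set G I \<longrightarrow> (\<Sum>i\<in>I. l i) < (\<Sum>j\<in>neighbours G I. l j)}"

definition maximal_policy :: "'v pair_pre_digraph \<Rightarrow> 'v policy \<Rightarrow> bool" where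
  "maximal_policy G \<Phi> \<longleftrightarrow> admissible G \<Phi> \<and> stability_region G \<Phi> = Ncond G"

definition matching_stable :: "'v pair_pre_digraph \<Rightarrow> bool" where
  "matching_stable G \<longleftrightarrow>
     G \<in> connected_graphs \<and> Ncond G \<noteq> {} \<and> (\<forall>\<Phi>. admissible G \<Phi> \<longrightarrow> maximal_policy G \<Phi>)"

end

theory Submission
  imports Defs
begin

text \<open>
  If \<open>G\<close> is matching-stable, then \<open>Ncond G\<close> is nonempty, so \<open>G\<close> is not bipartite and its shortest
  odd cycle is induced. Once induced 5-cycles and pendant graphs are excluded, that cycle is a
  triangle, and in a connected graph with a triangle but no induced pendant graph non-adjacency is
  an equivalence relation, whose classes separate \<open>G\<close>.

  An induced 5-cycle or pendant graph is excluded by a policy that is not maximal. Give the classes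
  of this core weights in \<open>[0, 1]\<close> and all other classes weight \<open>-1\<close>, and let arriving items be
  matched with an available item of least weight. For suitable rates in the core, and tiny ones
  outside, the weighted queue length \<open>f\<close> has nonnegative drift wherever it is positive, and increases
  by at most 1 per arrival. Optional stopping then shows that \<open>f\<close> stays positive for \<open>k\<close> arrivals
  with probability at least \<open>f z / (f z + k)\<close>, and the divergence of the harmonic series makes the
  mean return time to the empty queue infinite.
\<close>

section \<open>Products of exponential distributions\<close>

text \<open>The optional stopping argument uses no filtration and no embedded Markov chain. The
  sample space is a product of gap and decision coordinates, so the proof bounds the return time
  from below by a function of the gaps that is defined by recursion over arrivals, and integrates
  this recursion. The probabilistic input is a renewal identity: on the event that class
  \<open>i\<close> arrives first, the remaining gaps have the law of the original ones, because the
  waits of the other classes are memoryless and the gaps of class \<open>i\<close> are merely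
  renumbered. The survival bound becomes an induction on the number of arrivals.

  The obstacle on the side of the graph is that a core sits in an arbitrary connected graph. The
  other classes must satisfy the inequalities of \<open>Ncond\<close> far from the core as well,
  where a uniformly small rate could fail, and their queued items must not help to empty the core.
  Cores are exhibited for two graphs only; longer induced odd cycles are what \<open>G7\<close> sets
  aside.\<close>

abbreviation expo :: "real \<Rightarrow> real measure" where
  "expo r \<equiv> density lborel (exponential_density r)"

text \<open>Memorylessness in integral form: the density at \<open>t + u\<close> is
  \<open>exp (- r * t)\<close> times the density at \<open>u\<close>.\<close>

lemma nn_integral_expo_shift:
  fixes g :: "real \<Rightarrow> ennreal"
  assumes g [measurable]: "g \<in> borel_measurable borel" and t: "0 \<le> t" and r: "0 < r"
  shows "(\<integral>\<^sup>+y. indicator {t<..} y * g (y - t) \<partial>expo r) = ennreal (exp (- r * t)) * (\<integral>\<^sup>+y. g y \<partial>expo r)"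
proof -
  have "(\<integral>\<^sup>+y. indicator {t<..} y * g (y - t) \<partial>expo r) =
      (\<integral>\<^sup>+y. ennreal (exponential_density r y) * (indicator {t<..} y * g (y - t)) \<partial>lborel)"
    by (subst nn_integral_density) auto
  also have "\<dots> = (\<integral>\<^sup>+u. ennreal (exponential_density r (t + 1 * u)) * (indicator {t<..} (t + 1 * u) * g (t + 1 * u - t)) \<partial>lborel)"
    by (subst nn_integral_real_affine[where c=1 and t=t]) auto
  also have "\<dots> = (\<integral>\<^sup>+u. ennreal (exp (- r * t)) * (ennreal (exponential_density r u) * g u) \<partial>lborel)"
  proof (rule nn_integral_cong_AE)
    \<comment> \<open>At \<open>u = 0\<close> the integrands may differ: the indicator vanishes
      there, the density does not.\<close>
    have "AE u in lborel. u \<noteq> (0::real)" by (rule AE_lborel_singleton)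
    then show "AE u in lborel. ennreal (exponential_density r (t + 1 * u)) * (indicator {t<..} (t + 1 * u) * g (t + 1 * u - t))
       = ennreal (exp (- r * t)) * (ennreal (exponential_density r u) * g u)"
    proof eventually_elim
      case (elim u)
      show ?case
      proof (cases "u > 0")
        case True
        have "exponential_density r (t + u) = exp (- r * t) * exponential_density r u"
          using True t by (simp add: exponential_density_def exp_add[symmetric] algebra_simps)
        then show ?thesis using True r
          by (simp add: ennreal_mult exponential_density_nonneg mult.assoc)
      next
        case False
        then show ?thesis using elim by (simp add: exponential_density_def)
      qed
    qed
  qed
  also have "\<dots> = ennreal (exp (- r * t)) * (\<integral>\<^sup>+u. ennreal (exponential_density r u) * g u \<partial>lborel)"
    by (rule nn_integral_cmult) auto
  also have "(\<integral>\<^sup>+u. ennreal (exponential_density r u) * g u \<partial>lborel) = (\<integral>\<^sup>+y. g y \<partial>expo r)"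
    by (subst nn_integral_density) auto
  finally show ?thesis .
qed

text \<open>Multiplying the density of rate \<open>r\<close> by \<open>exp (- s * t)\<close> gives a
  multiple of the density of rate \<open>r + s\<close>. With \<open>s\<close> the total rate of all
  competitors, the value is the probability that the class of rate \<open>r\<close> arrives
  first.\<close>

lemma nn_integral_expo_laplace:
  assumes r: "0 < r" and s: "0 \<le> s"
  shows "(\<integral>\<^sup>+t. ennreal (exp (- s * t)) \<partial>expo r) = ennreal (r / (r + s))"
proof -
  have "(\<integral>\<^sup>+t. ennreal (exp (- s * t)) \<partial>expo r) =
      (\<integral>\<^sup>+t. ennreal (exponential_density r t) * ennreal (exp (- s * t)) \<partial>lborel)"
    by (subst nn_integral_density) auto
  also have "\<dots> = (\<integral>\<^sup>+t. ennreal (r / (r + s)) * ennreal (exponential_density (r + s) t) \<partial>lborel)"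
  proof (rule nn_integral_cong)
    fix t :: real
    have "exponential_density r t * exp (- s * t) = r / (r + s) * exponential_density (r + s) t"
      using r s by (simp add: exponential_density_def exp_add[symmetric] algebra_simps add_divide_distrib[symmetric] field_split_simps)
    then show "ennreal (exponential_density r t) * ennreal (exp (- s * t)) =
        ennreal (r / (r + s)) * ennreal (exponential_density (r + s) t)"
      using r s by (simp add: ennreal_mult[symmetric] exponential_density_nonneg)
  qed
  also have "\<dots> = ennreal (r / (r + s)) * (\<integral>\<^sup>+t. ennreal (exponential_density (r + s) t) \<partial>lborel)"
    by (rule nn_integral_cmult) auto
  also have "(\<integral>\<^sup>+t. ennreal (exponential_density (r + s) t) \<partial>lborel) = emeasure (expo (r + s)) (space (expo (r + s)))"
    by (subst emeasure_density) auto
  also have "\<dots> = 1"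
    using prob_space_exponential_density[of "r + s"] r s by (intro prob_space.emeasure_space_1) auto
  finally show ?thesis by simp
qed

context
  fixes M :: "'i \<Rightarrow> 'a measure" and J :: "'i set" and a :: 'i
  assumes M: "\<And>i. i \<in> insert a J \<Longrightarrow> prob_space (M i)"
begin

lemma insert_PiM_measurable:
  assumes a: "a \<notin> J"
  shows "(\<lambda>(t, X). X(a := t)) \<in> M a \<Otimes>\<^sub>M Pi\<^sub>M J M \<rightarrow>\<^sub>M Pi\<^sub>M (insert a J) M"
proof -
  have "(\<lambda>p. (snd p)(a := fst p)) \<in> M a \<Otimes>\<^sub>M Pi\<^sub>M J M \<rightarrow>\<^sub>M Pi\<^sub>M (insert a J) M"
    by (rule measurable_fun_upd[where J=J]) auto
  then show ?thesis by (simp add: case_prod_beta')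
qed

text \<open>Fubini in both orders: the first conditions on the distinguished coordinate, the second
  integrates it while the others are fixed.\<close>

lemma nn_integral_PiM_insert:
  assumes a: "a \<notin> J" and F: "F \<in> borel_measurable (Pi\<^sub>M (insert a J) M)"
  shows nn_integral_PiM_insert_fst:
      "(\<integral>\<^sup>+x. F x \<partial>Pi\<^sub>M (insert a J) M) = (\<integral>\<^sup>+t. (\<integral>\<^sup>+X. F (X(a := t)) \<partial>Pi\<^sub>M J M) \<partial>M a)"
    and nn_integral_PiM_insert_snd:
      "(\<integral>\<^sup>+x. F x \<partial>Pi\<^sub>M (insert a J) M) = (\<integral>\<^sup>+X. (\<integral>\<^sup>+t. F (X(a := t)) \<partial>M a) \<partial>Pi\<^sub>M J M)"
proof -
  interpret A: prob_space "M a" using M by auto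
  interpret B: prob_space "Pi\<^sub>M J M" using M by (intro prob_space_PiM) auto
  interpret pair_sigma_finite "M a" "Pi\<^sub>M J M" ..
  note [measurable] = insert_PiM_measurable[OF a] F
  have "(\<integral>\<^sup>+x. F x \<partial>Pi\<^sub>M (insert a J) M) =
     (\<integral>\<^sup>+p. F (case p of (t, X) \<Rightarrow> X(a := t)) \<partial>(M a \<Otimes>\<^sub>M Pi\<^sub>M J M))"
    using M by (subst distr_pair_PiM_eq_PiM[symmetric]) (auto simp: nn_integral_distr)
  note * = this
  have meas: "(\<lambda>p. F (case p of (t, X) \<Rightarrow> X(a := t))) \<in> borel_measurable (M a \<Otimes>\<^sub>M Pi\<^sub>M J M)"
    by measurable
  show "(\<integral>\<^sup>+x. F x \<partial>Pi\<^sub>M (insert a J) M) = (\<integral>\<^sup>+t. (\<integral>\<^sup>+X. F (X(a := t)) \<partial>Pi\<^sub>M J M) \<partial>M a)"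
    unfolding * B.nn_integral_fst[OF meas, symmetric] by simp
  show "(\<integral>\<^sup>+x. F x \<partial>Pi\<^sub>M (insert a J) M) = (\<integral>\<^sup>+X. (\<integral>\<^sup>+t. F (X(a := t)) \<partial>M a) \<partial>Pi\<^sub>M J M)"
    unfolding * using nn_integral_snd[OF meas] by simp
qed

end

lemma nn_integral_PiM_expo_shift1:
  fixes r :: "'i \<Rightarrow> real" and F :: "('i \<Rightarrow> real) \<Rightarrow> ennreal"
  assumes r: "\<And>b. b \<in> I \<Longrightarrow> 0 < r b" and a: "a \<in> I" and t: "0 \<le> t"
    and F: "F \<in> borel_measurable (\<Pi>\<^sub>M b\<in>I. expo (r b))"
  shows "(\<integral>\<^sup>+x. indicator {t<..} (x a) * F (x(a := x a - t)) \<partial>(\<Pi>\<^sub>M b\<in>I. expo (r b))) =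
     ennreal (exp (- r a * t)) * (\<integral>\<^sup>+x. F x \<partial>(\<Pi>\<^sub>M b\<in>I. expo (r b)))"
proof -
  define J where "J = I - {a}"
  have I: "I = insert a J" and aJ: "a \<notin> J" using a by (auto simp: J_def)
  let ?M = "\<lambda>b. expo (r b)"
  have M: "\<And>i. i \<in> insert a J \<Longrightarrow> prob_space (?M i)"
    using r by (auto simp: I intro: prob_space_exponential_density)
  note [measurable] = F[unfolded I]
  have upd [measurable]: "(\<lambda>x. x(a := x a - t)) \<in> Pi\<^sub>M (insert a J) ?M \<rightarrow>\<^sub>M Pi\<^sub>M (insert a J) ?M"
    by (rule measurable_fun_upd[where J="insert a J"])
      (auto simp: measurable_cong_sets[OF refl sets_density] intro!: borel_measurable_diff)
  have meas: "(\<lambda>x. indicator {t<..} (x a) * F (x(a := x a - t))) \<in> borel_measurable (Pi\<^sub>M (insert a J) ?M)"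
    by measurable
  have "(\<integral>\<^sup>+x. indicator {t<..} (x a) * F (x(a := x a - t)) \<partial>Pi\<^sub>M (insert a J) ?M) =
     (\<integral>\<^sup>+X. (\<integral>\<^sup>+s. indicator {t<..} s * F (X(a := s - t)) \<partial>?M a) \<partial>Pi\<^sub>M J ?M)"
    by (subst nn_integral_PiM_insert_snd[OF M aJ meas]) simp_all
  also have "\<dots> = (\<integral>\<^sup>+X. ennreal (exp (- r a * t)) * (\<integral>\<^sup>+s. F (X(a := s)) \<partial>?M a) \<partial>Pi\<^sub>M J ?M)"
  proof (rule nn_integral_cong)
    fix X assume X: "X \<in> space (Pi\<^sub>M J ?M)"
    have "(\<lambda>s. X(a := s)) \<in> ?M a \<rightarrow>\<^sub>M Pi\<^sub>M (insert a J) ?M"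
      using measurable_Pair2'[OF X] X
      by (intro measurable_fun_upd[where J=J]) auto
    then have "(\<lambda>s. X(a := s)) \<in> borel \<rightarrow>\<^sub>M Pi\<^sub>M (insert a J) ?M"
      by (simp add: measurable_cong_sets[OF sets_density refl] cong: measurable_cong_sets)
    then have "(\<lambda>s. F (X(a := s))) \<in> borel_measurable borel" by measurable
    from nn_integral_expo_shift[OF this t r[OF a]]
    show "(\<integral>\<^sup>+s. indicator {t<..} s * F (X(a := s - t)) \<partial>?M a) =
       ennreal (exp (- r a * t)) * (\<integral>\<^sup>+s. F (X(a := s)) \<partial>?M a)" .
  qed
  also have "\<dots> = ennreal (exp (- r a * t)) * (\<integral>\<^sup>+X. (\<integral>\<^sup>+s. F (X(a := s)) \<partial>?M a) \<partial>Pi\<^sub>M J ?M)"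
  proof (rule nn_integral_cmult)
    interpret A: prob_space "?M a" using M by auto
    have "(\<lambda>p. (fst p)(a := snd p)) \<in> Pi\<^sub>M J ?M \<Otimes>\<^sub>M ?M a \<rightarrow>\<^sub>M Pi\<^sub>M (insert a J) ?M"
      by (rule measurable_fun_upd[where J=J]) auto
    then have "(\<lambda>p. F ((fst p)(a := snd p))) \<in> borel_measurable (Pi\<^sub>M J ?M \<Otimes>\<^sub>M ?M a)" by measurable
    then have "(\<lambda>(X, s). F (X(a := s))) \<in> borel_measurable (Pi\<^sub>M J ?M \<Otimes>\<^sub>M ?M a)"
      by (simp add: case_prod_beta')
    then show "(\<lambda>X. (\<integral>\<^sup>+s. F (X(a := s)) \<partial>?M a)) \<in> borel_measurable (Pi\<^sub>M J ?M)"
      by (rule A.borel_measurable_nn_integral)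
  qed
  also have "(\<integral>\<^sup>+X. (\<integral>\<^sup>+s. F (X(a := s)) \<partial>?M a) \<partial>Pi\<^sub>M J ?M) = (\<integral>\<^sup>+x. F x \<partial>Pi\<^sub>M (insert a J) ?M)"
    by (subst nn_integral_PiM_insert_snd[OF M aJ]) simp_all
  finally show ?thesis unfolding I .
qed

text \<open>Waiting for time \<open>t\<close> in several independent coordinates at once: the
  factors multiply, so the rates add up. It is applied to the first gaps of all classes but
  one.\<close>

lemma nn_integral_PiM_expo_shift:
  fixes r :: "'i \<Rightarrow> real" and F :: "('i \<Rightarrow> real) \<Rightarrow> ennreal"
  assumes r: "\<And>b. b \<in> I \<Longrightarrow> 0 < r b" and A: "finite A" "A \<subseteq> I" and t: "0 \<le> t"
    and F: "F \<in> borel_measurable (\<Pi>\<^sub>M b\<in>I. expo (r b))"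
  shows "(\<integral>\<^sup>+x. (\<Prod>a\<in>A. indicator {t<..} (x a)) * F (\<lambda>b. if b \<in> A then x b - t else x b) \<partial>(\<Pi>\<^sub>M b\<in>I. expo (r b))) =
     ennreal (exp (- (\<Sum>a\<in>A. r a) * t)) * (\<integral>\<^sup>+x. F x \<partial>(\<Pi>\<^sub>M b\<in>I. expo (r b)))"
  using A F
proof (induction A arbitrary: F)
  case empty
  then show ?case by simp
next
  case (insert a A)
  let ?P = "\<Pi>\<^sub>M b\<in>I. expo (r b)"
  have [measurable]: "F \<in> borel_measurable ?P" by fact
  have aI: "a \<in> I" and AI: "A \<subseteq> I" using insert by auto
  have upd [measurable]: "(\<lambda>x. x(a := x a - t)) \<in> ?P \<rightarrow>\<^sub>M ?P"
    using aI by (intro measurable_fun_upd[where J=I])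
      (auto simp: measurable_cong_sets[OF refl sets_density] intro!: borel_measurable_diff)
  have sh [measurable]: "(\<lambda>x b. if b \<in> A then x b - t else x b) \<in> ?P \<rightarrow>\<^sub>M ?P"
  proof (rule measurable_PiM_single')
    show "(\<lambda>x. if b \<in> A then x b - t else x b) \<in> ?P \<rightarrow>\<^sub>M expo (r b)" if "b \<in> I" for b
      using that by (cases "b \<in> A") (auto simp: measurable_cong_sets[OF refl sets_density] intro!: borel_measurable_diff)
    show "(\<lambda>x b. if b \<in> A then x b - t else x b) \<in> space ?P \<rightarrow> (\<Pi>\<^sub>E b\<in>I. space (expo (r b)))"
      using AI by (auto simp: space_PiM PiE_def extensional_def)
  qed
  \<comment> \<open>The shift of coordinate \<open>a\<close> is absorbed into the integrand, to
    which the induction hypothesis, stated for arbitrary \<open>F\<close>, then applies.\<close>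
  define F' where "F' = (\<lambda>x. indicator {t<..} (x a) * F (x(a := x a - t)))"
  have F': "F' \<in> borel_measurable ?P" unfolding F'_def using aI by measurable
  have "(\<Prod>a\<in>insert a A. indicator {t<..} (x a)) * F (\<lambda>b. if b \<in> insert a A then x b - t else x b)
     = (\<Prod>a\<in>A. indicator {t<..} (x a)) * F' (\<lambda>b. if b \<in> A then x b - t else x b)" for x
  proof -
    have "(\<lambda>b. if b \<in> insert a A then x b - t else x b) =
        (\<lambda>b. if b \<in> A then x b - t else x b)(a := x a - t)"
      using insert by auto
    then show ?thesis using insert by (simp add: F'_def mult_ac)
  qed
  then have "(\<integral>\<^sup>+x. (\<Prod>a\<in>insert a A. indicator {t<..} (x a)) * F (\<lambda>b. if b \<in> insert a A then x b - t else x b) \<partial>?P)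
     = ennreal (exp (- (\<Sum>a\<in>A. r a) * t)) * (\<integral>\<^sup>+x. F' x \<partial>?P)"
    using insert.IH[OF AI F'] by simp
  also have "(\<integral>\<^sup>+x. F' x \<partial>?P) = ennreal (exp (- r a * t)) * (\<integral>\<^sup>+x. F x \<partial>?P)"
    unfolding F'_def by (rule nn_integral_PiM_expo_shift1) (use r t aI in auto)
  also have "ennreal (exp (- (\<Sum>a\<in>A. r a) * t)) * (ennreal (exp (- r a * t)) * (\<integral>\<^sup>+x. F x \<partial>?P)) =
      ennreal (exp (- (\<Sum>a\<in>A. r a) * t) * exp (- r a * t)) * (\<integral>\<^sup>+x. F x \<partial>?P)"
    by (simp add: ennreal_mult mult.assoc)
  also have "exp (- (\<Sum>a\<in>A. r a) * t) * exp (- r a * t) = exp (- (\<Sum>a\<in>insert a A. r a) * t)"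
    using insert.hyps by (simp add: exp_add[symmetric] algebra_simps)
  finally show ?case .
qed

section \<open>The arrival process seen from its first arrival\<close>

text \<open>The gaps as seen at time \<open>x (i, 0)\<close>, when class \<open>i\<close> has just
  made the first arrival. Later gaps of another class are counted from its own arrivals, so only its
  first gap shrinks to a residual one.\<close>

definition restart :: "'v set \<Rightarrow> 'v \<Rightarrow> ('v \<times> nat \<Rightarrow> real) \<Rightarrow> 'v \<times> nat \<Rightarrow> real" where
  "restart V i x = (\<lambda>(j, k)\<in>V \<times> UNIV.
     if j = i then x (i, Suc k) else if k = 0 then x (j, 0) - x (i, 0) else x (j, k))"

text \<open>Strictness makes these events disjoint for different \<open>i\<close>, so a sum over
  classes weighted by their indicators has at most one nonzero term.\<close>

definition first_arrival :: "'v set \<Rightarrow> 'v \<Rightarrow> ('v \<times> nat \<Rightarrow> real) \<Rightarrow> bool" where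
  "first_arrival V i x \<longleftrightarrow> (\<forall>j\<in>V - {i}. x (i, 0) < x (j, 0))"

text \<open>\<open>arg_min_on\<close> is a choice among the minimisers. Both functions have the same
  minimisers, so even ties are broken in the same way.\<close>

lemma arg_min_on_shift:
  fixes f g :: "'v \<Rightarrow> real"
  assumes "\<And>j. j \<in> V \<Longrightarrow> f j = t + g j"
  shows "arg_min_on f V = arg_min_on g V"
proof -
  have "is_arg_min f (\<lambda>j. j \<in> V) j \<longleftrightarrow> is_arg_min g (\<lambda>j. j \<in> V) j" for j
    using assms by (auto simp: is_arg_min_def)
  then show ?thesis by (simp add: arg_min_on_def arg_min_def)
qed

text \<open>A restart translates all epochs by \<open>x (c, 0)\<close>. Only class \<open>c\<close>
  is renumbered, since its epoch 0 has become the origin of time.\<close>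

lemma epoch_restart:
  assumes "j \<in> V"
  shows "epoch x j (m + of_bool (j = c)) = x (c, 0) + epoch (restart V c x) j m"
proof (induction m)
  case 0
  then show ?case using assms by (auto simp: epoch_def restart_def)
next
  case (Suc m)
  then show ?case using assms by (auto simp: epoch_def restart_def)
qed

lemma class_counts_restart:
  fixes G :: "'v pair_pre_digraph" and x :: "'v \<times> nat \<Rightarrow> real"
  defines "c \<equiv> arrival_class G x 0"
  shows "class_counts G x (Suc n) j = class_counts G (restart (pverts G) c x) n j + of_bool (j = c)"
    and arrival_class_restart: "arrival_class G x (Suc n) = arrival_class G (restart (pverts G) c x) n"
proof -
  let ?x = "restart (pverts G) c x"
  \<comment> \<open>Counts and class go through one induction: the counts determine the next class,
    which determines the next counts.\<close>
  have "(\<forall>j. class_counts G x (Suc n) j = class_counts G ?x n j + of_bool (j = c)) \<and>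
    arrival_class G x (Suc n) = arrival_class G ?x n"
  proof (induction n)
    case 0
    have 1: "class_counts G x (Suc 0) j = class_counts G ?x 0 j + of_bool (j = c)" for j
      by (simp add: c_def arrival_class_def)
    have "arrival_class G x (Suc 0) = arrival_class G ?x 0"
      unfolding arrival_class_def[of G _ 0] arrival_class_def[of G _ "Suc 0"] 1
      by (rule arg_min_on_shift[of _ _ "x (c, 0)"]) (rule epoch_restart)
    with 1 show ?case by blast
  next
    case (Suc n)
    have "class_counts G x (Suc (Suc n)) = (class_counts G x (Suc n))
        (arrival_class G x (Suc n) := Suc (class_counts G x (Suc n) (arrival_class G x (Suc n))))"
      by (simp only: class_counts.simps(2)[of G x "Suc n"] Let_def arrival_class_def)
    moreover have "class_counts G ?x (Suc n) = (class_counts G ?x n)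
        (arrival_class G ?x n := Suc (class_counts G ?x n (arrival_class G ?x n)))"
      by (simp only: class_counts.simps(2) Let_def arrival_class_def)
    ultimately have 1: "class_counts G x (Suc (Suc n)) j = class_counts G ?x (Suc n) j + of_bool (j = c)" for j
      using Suc.IH by (simp del: class_counts.simps)
    have "arrival_class G x (Suc (Suc n)) = arrival_class G ?x (Suc n)"
      unfolding arrival_class_def[of G _ "Suc n"] arrival_class_def[of G _ "Suc (Suc n)"] 1
      by (rule arg_min_on_shift[of _ _ "x (c, 0)"]) (simp add: epoch_restart)
    with 1 show ?case by blast
  qed
  then show "class_counts G x (Suc n) j = class_counts G ?x n j + of_bool (j = c)"
    "arrival_class G x (Suc n) = arrival_class G ?x n" by auto
qed

context
  fixes G :: "'v pair_pre_digraph" and s :: "('v \<Rightarrow> nat) \<Rightarrow> 'v \<Rightarrow> ('v \<Rightarrow> nat)"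
begin

primrec run :: "('v \<times> nat \<Rightarrow> real) \<Rightarrow> ('v \<Rightarrow> nat) \<Rightarrow> nat \<Rightarrow> ('v \<Rightarrow> nat)" where
  "run x z 0 = z"
| "run x z (Suc n) = s (run x z n) (arrival_class G x n)"

text \<open>\<open>run\<close> unfolds at its last arrival, whereas the hitting-time recursion
  splits off the first.\<close>

lemma run_restart:
  "run x z (Suc n) = run (restart (pverts G) (arrival_class G x 0) x) (s z (arrival_class G x 0)) n"
  by (induction n) (simp_all add: arrival_class_restart)

end

section \<open>Arrival counts and the pathwise lower bound for hitting times\<close>

definition total_count :: "'v set \<Rightarrow> ('v \<times> nat \<Rightarrow> real) \<Rightarrow> real \<Rightarrow> nat" where
  "total_count V x t = (\<Sum>i\<in>V. poisson_count x i t)"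

text \<open>The almost sure properties of the gaps on which the pathwise arguments rest. Finiteness
  matters because \<open>poisson_count\<close> is a \<open>card\<close>, which is 0 for infinite
  sets.\<close>

definition regular :: "'v set \<Rightarrow> ('v \<times> nat \<Rightarrow> real) \<Rightarrow> bool" where
  "regular V x \<longleftrightarrow> (\<forall>i\<in>V. (\<forall>k. 0 \<le> x (i, k)) \<and> (\<forall>t. finite {k. epoch x i k \<le> t}))"

context
  fixes V :: "'v set" and c :: 'v and x :: "'v \<times> nat \<Rightarrow> real"
  assumes V: "finite V" and c: "c \<in> V" "\<And>j. j \<in> V \<Longrightarrow> x (c, 0) \<le> x (j, 0)" and x: "regular V x"
begin

lemma epochs_restart:
  assumes j: "j \<in> V" and t: "x (c, 0) \<le> t"
  shows "{k. epoch x j k \<le> t} = (if j = c then insert 0 (Suc ` {k. epoch (restart V c x) j k \<le> t - x (c, 0)})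
    else {k. epoch (restart V c x) j k \<le> t - x (c, 0)})"
proof (cases "j = c")
  case True
  have "epoch x c 0 \<le> t" using t by (simp add: epoch_def)
  moreover have "epoch x c (Suc k) = x (c, 0) + epoch (restart V c x) c k" for k
    using epoch_restart[of c V x k c] c by simp
  then have "Suc k \<in> {k. epoch x c k \<le> t} \<longleftrightarrow> k \<in> {k. epoch (restart V c x) c k \<le> t - x (c, 0)}" for k
    by (simp add: algebra_simps)
  ultimately have "k \<in> {k. epoch x c k \<le> t} \<longleftrightarrow>
      k \<in> insert 0 (Suc ` {k. epoch (restart V c x) c k \<le> t - x (c, 0)})" for k
    by (cases k) auto
  with True show ?thesis by auto
next
  case False
  then show ?thesis using epoch_restart[OF j, of x _ c] by (auto simp: algebra_simps)
qed

lemma regular_restart: "regular V (restart V c x)"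
proof -
  have "0 \<le> restart V c x (j, k)" if "j \<in> V" for j k
    using that c x by (auto simp: restart_def regular_def)
  moreover have "finite {k. epoch (restart V c x) j k \<le> t}" if j: "j \<in> V" for j t
  proof -
    \<comment> \<open>The maximum with 0 keeps the bound at or above \<open>x (c, 0)\<close>, as
      \<open>epochs_restart\<close> requires.\<close>
    have "finite {k. epoch x j k \<le> max t 0 + x (c, 0)}" using x j by (auto simp: regular_def)
    then have "finite {k. epoch (restart V c x) j k \<le> max t 0}"
      using epochs_restart[OF j, of "max t 0 + x (c, 0)"] by (auto split: if_splits simp: finite_image_iff)
    then show ?thesis by (rule rev_finite_subset) auto
  qed
  ultimately show ?thesis by (simp add: regular_def)
qed

lemma poisson_count_restart:
  assumes j: "j \<in> V" and t: "x (c, 0) \<le> t"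
  shows "poisson_count x j t = poisson_count (restart V c x) j (t - x (c, 0)) + of_bool (j = c)"
proof -
  have "finite {k. epoch (restart V c x) j k \<le> t - x (c, 0)}"
    using regular_restart j by (auto simp: regular_def)
  then show ?thesis unfolding poisson_count_def epochs_restart[OF assms]
    by (auto simp: card_insert_if card_image)
qed

lemma total_count_restart:
  assumes t: "x (c, 0) \<le> t"
  shows "total_count V x t = Suc (total_count V (restart V c x) (t - x (c, 0)))"
proof -
  have "(\<Sum>j\<in>V. poisson_count x j t) = (\<Sum>j\<in>V. poisson_count (restart V c x) j (t - x (c, 0)) + of_bool (j = c))"
    by (intro sum.cong refl poisson_count_restart t)
  also have "\<dots> = (\<Sum>j\<in>V. poisson_count (restart V c x) j (t - x (c, 0))) + (\<Sum>j\<in>V. of_bool (j = c))"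
    by (rule sum.distrib)
  also have "(\<Sum>j\<in>V. of_bool (j = c)) = (1 :: nat)" using V c by (simp add: of_bool_def)
  finally show ?thesis by (simp add: total_count_def)
qed

lemma first_arrival_le:
  assumes "total_count V x t \<noteq> 0"
  shows "x (c, 0) \<le> t"
proof -
  from assms V obtain j where j: "j \<in> V" "poisson_count x j t \<noteq> 0"
    by (auto simp: total_count_def)
  then have "{k. epoch x j k \<le> t} \<noteq> {}" by (metis card.empty poisson_count_def)
  then obtain k where k: "epoch x j k \<le> t" by blast
  have "x (c, 0) \<le> x (j, 0)" using c j by blast
  also have "\<dots> = (\<Sum>m\<in>{0}. x (j, m))" by simp
  also have "\<dots> \<le> epoch x j k" unfolding epoch_def
    using x j by (intro sum_mono2) (auto simp: regular_def)
  finally show ?thesis using k by simp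
qed

end

lemma arrival_class_0:
  assumes "finite (pverts G)" "pverts G \<noteq> {}"
  shows "arrival_class G x 0 \<in> pverts G"
    and "j \<in> pverts G \<Longrightarrow> x (arrival_class G x 0, 0) \<le> x (j, 0)"
  using arg_min_if_finite(1)[OF assms, of "\<lambda>i. epoch x i (class_counts G x 0 i)"]
    arg_min_least[OF assms, of j "\<lambda>i. epoch x i (class_counts G x 0 i)"]
  by (auto simp: arrival_class_def epoch_def)

text \<open>
  A lower bound for the time at which \<open>f\<close> is first nonpositive, capped at the \<open>m\<close>-th
  arrival. Ties between first arrivals cut the recursion short, which keeps it a lower bound.
\<close>

primrec capped_hitting_time :: "'v set \<Rightarrow> (('v \<Rightarrow> nat) \<Rightarrow> 'v \<Rightarrow> ('v \<Rightarrow> nat)) \<Rightarrow> (('v \<Rightarrow> nat) \<Rightarrow> real) \<Rightarrow>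
    nat \<Rightarrow> ('v \<Rightarrow> nat) \<Rightarrow> ('v \<times> nat \<Rightarrow> real) \<Rightarrow> ennreal" where
  "capped_hitting_time V s f 0 z x = 0"
| "capped_hitting_time V s f (Suc m) z x = ennreal (MIN i\<in>V. x (i, 0)) +
     (\<Sum>i\<in>V. if 0 < f (s z i) then of_bool (first_arrival V i x) * capped_hitting_time V s f m (s z i) (restart V i x) else 0)"

text \<open>The induction follows the path from arrival to arrival. A nonzero count puts the first
  arrival before \<open>t\<close>; if \<open>f\<close> is positive after it, the nonpositive value
  at \<open>t\<close> requires a further arrival, which restores the hypotheses for the restarted
  sample and the remaining time.\<close>

lemma capped_hitting_time_le:
  assumes V: "V = pverts G" "finite V" "V \<noteq> {}"
    and "regular V x" "total_count V x t \<noteq> 0" "f (run G s x z (total_count V x t)) \<le> 0"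
  shows "capped_hitting_time V s f m z x \<le> ennreal t"
  using assms(4-6)
proof (induction m arbitrary: z x t)
  case 0
  then show ?case by simp
next
  case (Suc m)
  define c where "c = arrival_class G x 0"
  define x' where "x' = restart V c x"
  have c: "c \<in> V" "\<And>j. j \<in> V \<Longrightarrow> x (c, 0) \<le> x (j, 0)"
    using arrival_class_0[of G] V by (auto simp: c_def)
  note ctxt = V(2) c Suc.prems(1)
  have t: "x (c, 0) \<le> t" using first_arrival_le[OF ctxt Suc.prems(2)] .
  have x0: "0 \<le> x (c, 0)" using Suc.prems(1) c by (auto simp: regular_def)
  have count: "total_count V x t = Suc (total_count V x' (t - x (c, 0)))"
    unfolding x'_def by (rule total_count_restart[OF ctxt t])
  have run: "run G s x z (total_count V x t) = run G s x' (s z c) (total_count V x' (t - x (c, 0)))"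
    unfolding count run_restart by (simp add: x'_def c_def V)
  have min: "(MIN i\<in>V. x (i, 0)) = x (c, 0)"
    using V c by (intro Min_eqI) auto
  \<comment> \<open>No class other than \<open>c\<close> is strictly first, so only its summand can
    survive; in a tie even that one vanishes.\<close>
  have "(\<Sum>i\<in>V. if 0 < f (s z i) then of_bool (first_arrival V i x) * capped_hitting_time V s f m (s z i) (restart V i x) else 0)
     = (\<Sum>i\<in>V. if i = c then (if 0 < f (s z c) then of_bool (first_arrival V c x) * capped_hitting_time V s f m (s z c) x' else 0) else 0)"
  proof (rule sum.cong[OF refl])
    fix i assume i: "i \<in> V"
    have "\<not> first_arrival V i x" if "i \<noteq> c"
      using that c(1) c(2)[OF i] by (auto simp: first_arrival_def not_less intro!: bexI[of _ c])
    then show "(if 0 < f (s z i) then of_bool (first_arrival V i x) * capped_hitting_time V s f m (s z i) (restart V i x) else 0)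
      = (if i = c then (if 0 < f (s z c) then of_bool (first_arrival V c x) * capped_hitting_time V s f m (s z c) x' else 0) else 0)"
      by (auto simp: x'_def)
  qed
  also have "\<dots> = (if 0 < f (s z c) then of_bool (first_arrival V c x) * capped_hitting_time V s f m (s z c) x' else 0)"
    using V c by simp
  also have "\<dots> \<le> ennreal (t - x (c, 0))"
  proof (cases "0 < f (s z c)")
    case True
    have "total_count V x' (t - x (c, 0)) \<noteq> 0"
    proof
      assume "total_count V x' (t - x (c, 0)) = 0"
      with run Suc.prems(3) have "f (s z c) \<le> 0" by simp
      with True show False by simp
    qed
    moreover have "f (run G s x' (s z c) (total_count V x' (t - x (c, 0)))) \<le> 0"
      using run Suc.prems(3) by simp
    ultimately have "capped_hitting_time V s f m (s z c) x' \<le> ennreal (t - x (c, 0))"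
      using Suc.IH regular_restart[OF ctxt] unfolding x'_def by blast
    then show ?thesis by (auto simp: of_bool_def)
  qed simp
  finally have "capped_hitting_time V s f (Suc m) z x \<le> ennreal (x (c, 0)) + ennreal (t - x (c, 0))"
    unfolding capped_hitting_time.simps min by (intro add_left_mono)
  also have "\<dots> = ennreal t" using x0 t by (simp add: ennreal_plus[symmetric] del: ennreal_plus)
  finally show ?case .
qed

section \<open>The law of the arrival process after a restart\<close>

abbreviation arrival_measure :: "'v set \<Rightarrow> ('v \<Rightarrow> real) \<Rightarrow> ('v \<times> nat \<Rightarrow> real) measure" where
  "arrival_measure V l \<equiv> (\<Pi>\<^sub>M (i, k)\<in>V \<times> UNIV. expo (l i))"

lemma measurable_coord [measurable (raw)]:
  assumes "i \<in> V"
  shows "(\<lambda>x. x (i, k)) \<in> borel_measurable (arrival_measure V l)"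
proof -
  have "(\<lambda>x. x (i, k)) \<in> arrival_measure V l \<rightarrow>\<^sub>M (case (i, k) of (i, k) \<Rightarrow> expo (l i))"
    using assms by (intro measurable_component_singleton) auto
  then show ?thesis by (simp add: measurable_cong_sets[OF refl sets_density])
qed

lemma measurable_restart [measurable (raw)]:
  assumes "i \<in> V"
  shows "restart V i \<in> arrival_measure V l \<rightarrow>\<^sub>M arrival_measure V l"
  unfolding restart_def
proof (rule measurable_restrict)
  fix p :: "'a \<times> nat" assume p: "p \<in> V \<times> UNIV"
  obtain j k where jk: "p = (j, k)" "j \<in> V" using p by auto
  have "(\<lambda>x. if j = i then x (i, Suc k) else if k = 0 then x (j, 0) - x (i, 0) else x (j, k))
      \<in> borel_measurable (arrival_measure V l)"
    using assms jk by measurable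
  then show "(\<lambda>x. case p of (j, k) \<Rightarrow> if j = i then x (i, Suc k) else if k = 0 then x (j, 0) - x (i, 0) else x (j, k))
    \<in> arrival_measure V l \<rightarrow>\<^sub>M (case p of (i, k) \<Rightarrow> expo (l i))"
    by (simp add: jk measurable_cong_sets[OF refl sets_density])
qed

lemma measurable_first_arrival [measurable]:
  assumes "finite V" "i \<in> V"
  shows "Measurable.pred (arrival_measure V l) (first_arrival V i)"
  unfolding first_arrival_def
proof (rule pred_intros_finite(3))
  show "finite (V - {i})" using assms by auto
  fix j assume "j \<in> V - {i}"
  then have [measurable]: "(\<lambda>x. x (j, 0)) \<in> borel_measurable (arrival_measure V l)"
    "(\<lambda>x. x (i, 0)) \<in> borel_measurable (arrival_measure V l)"
    using assms by (auto intro: measurable_coord)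
  show "Measurable.pred (arrival_measure V l) (\<lambda>x. x (i, 0) < x (j, 0))" by measurable
qed

context
  fixes V :: "'v set" and l :: "'v \<Rightarrow> real"
  assumes V: "finite V" and l: "\<And>i. i \<in> V \<Longrightarrow> 0 < l i"
begin

lemma prob_space_arrivals: "prob_space (arrival_measure V l)"
  using l by (intro prob_space_PiM) (auto intro: prob_space_exponential_density)

text \<open>The renewal identity at the first arrival. Given \<open>x (i, 0) = t\<close>, the other
  first gaps must exceed \<open>t\<close> and their residuals are again exponential, at the cost of
  the factor \<open>exp (- s * t)\<close>. Integrating this factor over \<open>t\<close> gives the
  probability that class \<open>i\<close> is first.\<close>

lemma nn_integral_restart:
  assumes i: "i \<in> V" and H: "H \<in> borel_measurable (arrival_measure V l)"
  shows "(\<integral>\<^sup>+x. of_bool (first_arrival V i x) * H (restart V i x) \<partial>arrival_measure V l) =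
     ennreal (l i / (\<Sum>j\<in>V. l j)) * (\<integral>\<^sup>+x. H x \<partial>arrival_measure V l)"
proof -
  define K where "K = V \<times> (UNIV :: nat set) - {(i, 0)}"
  define A where "A = (V - {i}) \<times> {0 :: nat}"
  define M where "M = (\<lambda>(i, k :: nat). expo (l i))"
  \<comment> \<open>\<open>f\<close> names the old coordinate from which each restarted coordinate
    is read, up to the subtraction of \<open>t\<close>. It injects all coordinates into
    \<open>K\<close>, the old ones without \<open>(i, 0)\<close>, and preserves the marginals, so
    reindexing by \<open>f\<close> carries the product over \<open>K\<close> to the full
    product.\<close>
  define f where "f = (\<lambda>(j, k). if j = i then (i, Suc k) else (j, k :: nat))"
  define s where "s = (\<Sum>j\<in>V - {i}. l j)"
  define G where "G = (\<lambda>t x. (\<Prod>a\<in>A. indicator {t<..} (x a :: real)) * H (\<lambda>b. if b \<in> A then x b - t else x b))"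
  let ?P = "Pi\<^sub>M (V \<times> UNIV) M"
  have P: "arrival_measure V l = ?P" by (simp add: M_def case_prod_beta')
  note [measurable] = H[unfolded P]
  have KI: "insert (i, 0) K = V \<times> UNIV" and notK: "(i, 0) \<notin> K" using i by (auto simp: K_def)
  have M: "prob_space (M a)" if "a \<in> V \<times> UNIV" for a
    using that l by (auto simp: M_def intro: prob_space_exponential_density)
  have A: "finite A" "A \<subseteq> V \<times> UNIV" using V by (auto simp: A_def)
  have l': "0 < l (fst b)" if "b \<in> V \<times> (UNIV :: nat set)" for b
    using that l by auto
  have M': "M = (\<lambda>b. expo (l (fst b)))" by (auto simp: M_def)
  have G: "(\<integral>\<^sup>+x. G t x \<partial>?P) = ennreal (exp (- s * t)) * (\<integral>\<^sup>+x. H x \<partial>?P)" if "0 \<le> t" for t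
  proof -
    have "(\<Sum>a\<in>A. l (fst a)) = s"
      unfolding A_def s_def by (rule sum.reindex_cong[of "\<lambda>j. (j, 0)"]) (auto simp: inj_on_def)
    then show ?thesis
      using nn_integral_PiM_expo_shift[of "V \<times> UNIV" "\<lambda>b. l (fst b)", OF l' A that, of H] H
      by (simp add: G_def M' P)
  qed
  have Gm: "G t \<in> borel_measurable ?P" for t
  proof -
    have c: "(\<lambda>x. x b) \<in> borel_measurable ?P" if "b \<in> V \<times> UNIV" for b
      using measurable_component_singleton[OF that, of M] that by (auto simp: M_def measurable_cong_sets[OF refl sets_density])
    have "(\<lambda>x b. if b \<in> A then x b - t else x b) \<in> ?P \<rightarrow>\<^sub>M ?P"
    proof (rule measurable_PiM_single')
      show "(\<lambda>x. if b \<in> A then x b - t else x b) \<in> ?P \<rightarrow>\<^sub>M M b" if "b \<in> V \<times> UNIV" for b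
        using c[OF that] by (cases "b \<in> A") (auto simp: M' measurable_cong_sets[OF refl sets_density])
      show "(\<lambda>x b. if b \<in> A then x b - t else x b) \<in> space ?P \<rightarrow> (\<Pi>\<^sub>E b\<in>V \<times> UNIV. space (M b))"
        using A by (auto simp: space_PiM PiE_def extensional_def M')
    qed
    then have "(\<lambda>x. H (\<lambda>b. if b \<in> A then x b - t else x b)) \<in> borel_measurable ?P" by measurable
    moreover have "(\<lambda>x. \<Prod>a\<in>A. indicator {t<..} (x a) :: ennreal) \<in> borel_measurable ?P"
    proof (rule borel_measurable_prod_ennreal)
      fix a assume "a \<in> A"
      with A have [measurable]: "(\<lambda>x. x a) \<in> borel_measurable ?P" by (auto intro: c)
      show "(\<lambda>x. indicator {t<..} (x a) :: ennreal) \<in> borel_measurable ?P" by measurable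
    qed
    ultimately show ?thesis unfolding G_def by measurable
  qed
  have fM: "M (f a) = M a" for a by (auto simp: M_def f_def split: prod.splits)
  have reindex: "distr (Pi\<^sub>M K M) ?P (\<lambda>x. \<lambda>a\<in>V \<times> UNIV. x (f a)) = ?P"
  proof -
    have "f a \<in> K" if "a \<in> V \<times> UNIV" for a
      using that i by (cases a) (auto simp: K_def f_def)
    moreover have "inj_on f (V \<times> UNIV)"
      by (rule inj_onI) (auto simp: f_def split: if_splits)
    moreover have "prob_space (M a)" if "a \<in> K" for a
      using that M by (simp add: K_def)
    ultimately show ?thesis
      using distr_PiM_reindex[of K M f "V \<times> UNIV"] unfolding fM by blast
  qed
  have reidxm: "(\<lambda>x. \<lambda>a\<in>V \<times> UNIV. x (f a)) \<in> Pi\<^sub>M K M \<rightarrow>\<^sub>M ?P"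
  proof (rule measurable_restrict)
    fix a :: "'v \<times> nat" assume "a \<in> V \<times> UNIV"
    then have "f a \<in> K" using i by (auto simp: K_def f_def split: prod.splits)
    then show "(\<lambda>x. x (f a)) \<in> Pi\<^sub>M K M \<rightarrow>\<^sub>M M a"
      using measurable_component_singleton[of "f a" K M] by (simp add: fM)
  qed
  \<comment> \<open>Once the first gap of class \<open>i\<close> is fixed as \<open>t\<close>,
    restarting means reindexing by \<open>f\<close> and subtracting \<open>t\<close> on
    \<open>A\<close>, the first gaps of the other classes.\<close>
  have eq: "of_bool (first_arrival V i (X((i, 0) := t))) * H (restart V i (X((i, 0) := t))) =
      G t (\<lambda>a\<in>V \<times> UNIV. X (f a))" for t X
  proof -
    let ?Y = "\<lambda>a\<in>V \<times> UNIV. X (f a)"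
    have "(\<Prod>a\<in>A. indicator {t<..} (?Y a) :: ennreal) = (\<Prod>j\<in>V - {i}. indicator {t<..} (X (j, 0)))"
      unfolding A_def by (rule prod.reindex_cong[of "\<lambda>j. (j, 0)"]) (auto simp: inj_on_def f_def)
    also have "\<dots> = of_bool (first_arrival V i (X((i, 0) := t)))"
    proof (cases "first_arrival V i (X((i, 0) := t))")
      case True
      then have "\<forall>j\<in>V - {i}. indicator {t<..} (X (j, 0)) = (1 :: ennreal)"
        by (auto simp: first_arrival_def)
      with True show ?thesis by simp
    next
      case False
      then obtain j where "j \<in> V - {i}" "\<not> t < X (j, 0)"
        by (auto simp: first_arrival_def)
      then have "\<exists>j\<in>V - {i}. indicator {t<..} (X (j, 0)) = (0 :: ennreal)"
        by (intro bexI[of _ j]) auto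
      with False V show ?thesis by (simp add: prod_zero)
    qed
    finally have 1: "(\<Prod>a\<in>A. indicator {t<..} (?Y a) :: ennreal) = of_bool (first_arrival V i (X((i, 0) := t)))" .
    have "(\<lambda>b. if b \<in> A then ?Y b - t else ?Y b) = restart V i (X((i, 0) := t))"
      by (auto simp: fun_eq_iff restart_def A_def f_def)
    then show ?thesis unfolding G_def 1 by (simp only:)
  qed
  have "(\<lambda>x. of_bool (first_arrival V i x) * H (restart V i x)) \<in> borel_measurable (arrival_measure V l)"
    using V i H by measurable
  then have meas: "(\<lambda>x. of_bool (first_arrival V i x) * H (restart V i x)) \<in> borel_measurable (Pi\<^sub>M (insert (i, 0) K) M)"
    by (simp only: P KI)
  have "(\<integral>\<^sup>+x. of_bool (first_arrival V i x) * H (restart V i x) \<partial>?P) =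
     (\<integral>\<^sup>+t. (\<integral>\<^sup>+X. of_bool (first_arrival V i (X((i, 0) := t))) * H (restart V i (X((i, 0) := t))) \<partial>Pi\<^sub>M K M) \<partial>M (i, 0))"
    using nn_integral_PiM_insert_fst[of "(i, 0)" K M, OF _ notK meas] M unfolding KI by blast
  also have "\<dots> = (\<integral>\<^sup>+t. (\<integral>\<^sup>+X. G t (\<lambda>a\<in>V \<times> UNIV. X (f a)) \<partial>Pi\<^sub>M K M) \<partial>M (i, 0))"
    by (simp only: eq)
  also have "\<dots> = (\<integral>\<^sup>+t. (\<integral>\<^sup>+Y. G t Y \<partial>?P) \<partial>M (i, 0))"
    using nn_integral_distr[OF reidxm] Gm unfolding reindex by simp
  also have "\<dots> = (\<integral>\<^sup>+t. ennreal (exp (- s * t)) * (\<integral>\<^sup>+x. H x \<partial>?P) \<partial>expo (l i))"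
  proof -
    have "AE t in expo (l i). 0 \<le> t"
      by (subst AE_density) (auto simp: exponential_density_def)
    then show ?thesis unfolding M_def prod.case
      by (intro nn_integral_cong_AE) (auto simp: G[unfolded M_def])
  qed
  also have "\<dots> = (\<integral>\<^sup>+t. ennreal (exp (- s * t)) \<partial>expo (l i)) * (\<integral>\<^sup>+x. H x \<partial>?P)"
    by (rule nn_integral_multc) auto
  also have "(\<integral>\<^sup>+t. ennreal (exp (- s * t)) \<partial>expo (l i)) = ennreal (l i / (\<Sum>j\<in>V. l j))"
  proof -
    have "0 \<le> s" unfolding s_def using l by (intro sum_nonneg) (auto intro: less_imp_le)
    moreover have "(\<Sum>j\<in>V. l j) = l i + s" unfolding s_def using V i by (simp add: sum.remove)
    ultimately show ?thesis using nn_integral_expo_laplace[OF l[OF i], of s] by simp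
  qed
  finally show ?thesis by (simp only: P)
qed

end

section \<open>Instability from a nonnegative drift\<close>

lemma measurable_capped_hitting_time [measurable]:
  assumes V: "finite V"
  shows "capped_hitting_time V s f m z \<in> borel_measurable (arrival_measure V l)"
proof (induction m arbitrary: z)
  case 0
  then show ?case by simp
next
  case (Suc m)
  have min: "(\<lambda>x. MIN i\<in>V. x (i, 0)) \<in> borel_measurable (arrival_measure V l)"
    using V by (intro borel_measurable_Min measurable_coord)
  have "(\<lambda>x. if 0 < f (s z i) then of_bool (first_arrival V i x) * capped_hitting_time V s f m (s z i) (restart V i x) else 0)
      \<in> borel_measurable (arrival_measure V l)" if i: "i \<in> V" for i
  proof -
    note [measurable] = measurable_first_arrival[OF V i] measurable_compose[OF measurable_restart[OF i] Suc]
    show ?thesis by measurable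
  qed
  then show ?case using min by (auto intro!: borel_measurable_add borel_measurable_sum)
qed

context
  fixes V :: "'v set" and l :: "'v \<Rightarrow> real"
  assumes V: "finite V" "V \<noteq> {}" and l: "\<And>i. i \<in> V \<Longrightarrow> 0 < l i"
begin

interpretation arrivals: prob_space "arrival_measure V l"
  using V(1) l by (rule prob_space_arrivals)

lemma AE_arrivals_pos: "AE x in arrival_measure V l. \<forall>i\<in>V. \<forall>k. 0 < x (i, k)"
proof -
  have "AE x in arrival_measure V l. 0 < x (i, k)" if i: "i \<in> V" for i k
  proof (rule AE_PiM_component)
    show "AE t in (case (i, k) of (i, k) \<Rightarrow> expo (l i)). 0 < t"
    proof -
      have "AE t in lborel. t \<noteq> (0::real)" by (rule AE_lborel_singleton)
      then show ?thesis by (subst prod.case, subst AE_density) (auto simp: exponential_density_def)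
    qed
  qed (use i l in \<open>auto intro: prob_space_exponential_density\<close>)
  then show ?thesis using V by (simp add: AE_finite_all AE_all_countable)
qed

text \<open>Integrating the recursion by the renewal identity turns it into one for the means,
  weighted by the probabilities of the class of the first arrival.\<close>

lemma nn_integral_capped_hitting_time_Suc:
  "(\<integral>\<^sup>+x. capped_hitting_time V s f (Suc m) z x \<partial>arrival_measure V l) =
    (\<integral>\<^sup>+x. ennreal (MIN i\<in>V. x (i, 0)) \<partial>arrival_measure V l) +
    (\<Sum>i\<in>V. if 0 < f (s z i) then ennreal (l i / (\<Sum>j\<in>V. l j)) *
       (\<integral>\<^sup>+x. capped_hitting_time V s f m (s z i) x \<partial>arrival_measure V l) else 0)"
proof -
  let ?P = "arrival_measure V l"
  have min: "(\<lambda>x. MIN i\<in>V. x (i, 0)) \<in> borel_measurable ?P"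
    using V by (intro borel_measurable_Min measurable_coord)
  have meas: "(\<lambda>x. if 0 < f (s z i) then of_bool (first_arrival V i x) * capped_hitting_time V s f m (s z i) (restart V i x) else 0)
      \<in> borel_measurable ?P" if i: "i \<in> V" for i
  proof -
    note [measurable] = measurable_first_arrival[OF V(1) i]
      measurable_compose[OF measurable_restart[OF i] measurable_capped_hitting_time[OF V(1)]]
    show ?thesis by measurable
  qed
  have "(\<integral>\<^sup>+x. capped_hitting_time V s f (Suc m) z x \<partial>?P) =
     (\<integral>\<^sup>+x. ennreal (MIN i\<in>V. x (i, 0)) \<partial>?P) +
     (\<integral>\<^sup>+x. (\<Sum>i\<in>V. if 0 < f (s z i) then of_bool (first_arrival V i x) * capped_hitting_time V s f m (s z i) (restart V i x) else 0) \<partial>?P)"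
    unfolding capped_hitting_time.simps
    using min meas by (intro nn_integral_add) (auto intro!: borel_measurable_sum)
  also have "(\<integral>\<^sup>+x. (\<Sum>i\<in>V. if 0 < f (s z i) then of_bool (first_arrival V i x) * capped_hitting_time V s f m (s z i) (restart V i x) else 0) \<partial>?P)
     = (\<Sum>i\<in>V. (\<integral>\<^sup>+x. (if 0 < f (s z i) then of_bool (first_arrival V i x) * capped_hitting_time V s f m (s z i) (restart V i x) else 0) \<partial>?P))"
    by (rule nn_integral_sum) (rule meas)
  also have "\<dots> = (\<Sum>i\<in>V. if 0 < f (s z i) then ennreal (l i / (\<Sum>j\<in>V. l j)) *
       (\<integral>\<^sup>+x. capped_hitting_time V s f m (s z i) x \<partial>?P) else 0)"
  proof (rule sum.cong[OF refl])
    fix i assume i: "i \<in> V"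
    show "(\<integral>\<^sup>+x. (if 0 < f (s z i) then of_bool (first_arrival V i x) * capped_hitting_time V s f m (s z i) (restart V i x) else 0) \<partial>?P)
      = (if 0 < f (s z i) then ennreal (l i / (\<Sum>j\<in>V. l j)) *
       (\<integral>\<^sup>+x. capped_hitting_time V s f m (s z i) x \<partial>?P) else 0)"
      using nn_integral_restart[OF V(1) l i measurable_capped_hitting_time[OF V(1)]] by simp
  qed
  finally show ?thesis .
qed

context
  fixes S :: "('v \<Rightarrow> nat) set" and s :: "('v \<Rightarrow> nat) \<Rightarrow> 'v \<Rightarrow> ('v \<Rightarrow> nat)" and f :: "('v \<Rightarrow> nat) \<Rightarrow> real"
  assumes S: "\<And>z i. z \<in> S \<Longrightarrow> i \<in> V \<Longrightarrow> s z i \<in> S"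
    and incr: "\<And>z i. z \<in> S \<Longrightarrow> i \<in> V \<Longrightarrow> f (s z i) \<le> f z + 1"
    and drift: "\<And>z. z \<in> S \<Longrightarrow> 0 < f z \<Longrightarrow> (\<Sum>i\<in>V. l i * f z) \<le> (\<Sum>i\<in>V. l i * f (s z i))"
begin

text \<open>One arrival in the survival bound. Since \<open>f\<close> grows by at most 1,
  \<open>f (s z i) + k\<close> is at most \<open>f z + (k + 1)\<close>, so the positive terms only
  increase when the denominator is replaced; the nonpositive ones are raised to 0. Later
  \<open>d\<close> is \<open>f z\<close>, except at the empty queue, where it is the mean of
  \<open>f\<close> after one arrival.\<close>

lemma sum_ratio_step:
  fixes k :: nat
  assumes z: "z \<in> S" "0 \<le> f z" and d: "(\<Sum>i\<in>V. l i * d) \<le> (\<Sum>i\<in>V. l i * f (s z i))"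
  shows "d / (f z + (real k + 1)) \<le> (\<Sum>i\<in>V. if 0 < f (s z i) then l i / (\<Sum>j\<in>V. l j) * (f (s z i) / (f (s z i) + real k)) else 0)"
proof -
  let ?L = "\<Sum>j\<in>V. l j"
  have L: "0 < ?L" using V l by (intro sum_pos) auto
  have "d = (\<Sum>i\<in>V. l i * d) / ?L" using L by (simp add: sum_distrib_right[symmetric])
  also have "\<dots> \<le> (\<Sum>i\<in>V. l i * f (s z i)) / ?L" using d L by (intro divide_right_mono) auto
  finally have "d / (f z + (real k + 1)) \<le> (\<Sum>i\<in>V. l i * f (s z i)) / ?L / (f z + (real k + 1))"
    using z by (intro divide_right_mono) auto
  also have "\<dots> = (\<Sum>i\<in>V. l i / ?L * (f (s z i) / (f z + (real k + 1))))"
    by (simp add: sum_divide_distrib)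
  also have "\<dots> \<le> (\<Sum>i\<in>V. if 0 < f (s z i) then l i / ?L * (f (s z i) / (f (s z i) + real k)) else 0)"
  proof (rule sum_mono)
    fix i assume i: "i \<in> V"
    have p: "0 \<le> l i / ?L" using l[OF i] L by simp
    show "l i / ?L * (f (s z i) / (f z + (real k + 1))) \<le>
      (if 0 < f (s z i) then l i / ?L * (f (s z i) / (f (s z i) + real k)) else 0)"
    proof (cases "0 < f (s z i)")
      case True
      then have "f (s z i) / (f z + (real k + 1)) \<le> f (s z i) / (f (s z i) + real k)"
        using incr[OF z(1) i] by (intro divide_left_mono mult_pos_pos) auto
      from mult_left_mono[OF this p] True show ?thesis by simp
    next
      case False
      then have "f (s z i) / (f z + (real k + 1)) \<le> 0"
        using z by (intro divide_nonpos_pos) auto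
      from mult_nonneg_nonpos[OF p this] False show ?thesis by simp
    qed
  qed
  finally show ?thesis .
qed

text \<open>Each survived arrival contributes another mean wait \<open>\<kappa>\<close>, so the mean
  time is at least \<open>\<kappa>\<close> times the sum of the survival bounds. The summand 1
  stands for the wait until the first arrival, which always takes place.\<close>

lemma mean_capped_hitting_time_ge_step:
  fixes \<kappa> :: ennreal
  defines "\<kappa> \<equiv> (\<integral>\<^sup>+x. ennreal (MIN i\<in>V. x (i, 0)) \<partial>arrival_measure V l)"
  assumes z: "z \<in> S" "0 \<le> f z" and d: "(\<Sum>i\<in>V. l i * d) \<le> (\<Sum>i\<in>V. l i * f (s z i))"
    and IH: "\<And>i. i \<in> V \<Longrightarrow> 0 < f (s z i) \<Longrightarrow>
      \<kappa> * ennreal (\<Sum>k<m. f (s z i) / (f (s z i) + real k)) \<le> (\<integral>\<^sup>+x. capped_hitting_time V s f m (s z i) x \<partial>arrival_measure V l)"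
  shows "\<kappa> * ennreal (1 + (\<Sum>k<m. d / (f z + (real k + 1)))) \<le>
    (\<integral>\<^sup>+x. capped_hitting_time V s f (Suc m) z x \<partial>arrival_measure V l)"
proof -
  let ?L = "\<Sum>j\<in>V. l j"
  have L: "0 < ?L" using V l by (intro sum_pos) auto
  define b where "b = (\<lambda>i. if 0 < f (s z i) then l i / ?L * (\<Sum>k<m. f (s z i) / (f (s z i) + real k)) else 0)"
  have b: "0 \<le> b i" if "i \<in> V" for i
  proof -
    have "0 \<le> l i / ?L" using l[OF that] L by simp
    then show ?thesis
      by (auto simp: b_def simp del: times_divide_eq_left intro!: mult_nonneg_nonneg sum_nonneg)
  qed
  have "(\<Sum>k<m. d / (f z + (real k + 1))) \<le>
      (\<Sum>k<m. \<Sum>i\<in>V. if 0 < f (s z i) then l i / ?L * (f (s z i) / (f (s z i) + real k)) else 0)"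
    by (intro sum_mono sum_ratio_step z d)
  also have "\<dots> = (\<Sum>i\<in>V. b i)"
    unfolding b_def by (subst sum.swap) (auto intro!: sum.cong simp: sum_distrib_left)
  finally have "\<kappa> * ennreal (1 + (\<Sum>k<m. d / (f z + (real k + 1)))) \<le> \<kappa> * ennreal (1 + (\<Sum>i\<in>V. b i))"
    by (intro mult_left_mono ennreal_leI) auto
  also have "\<dots> = \<kappa> + (\<Sum>i\<in>V. \<kappa> * ennreal (b i))"
  proof -
    have "(\<Sum>i\<in>V. ennreal (b i)) = ennreal (\<Sum>i\<in>V. b i)" using b by (rule sum_ennreal)
    moreover have "ennreal (1 + (\<Sum>i\<in>V. b i)) = 1 + ennreal (\<Sum>i\<in>V. b i)"
      using b by (subst ennreal_plus) (auto intro: sum_nonneg)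
    ultimately show ?thesis by (metis distrib_left mult.right_neutral sum_distrib_left)
  qed
  also have "\<dots> \<le> \<kappa> + (\<Sum>i\<in>V. if 0 < f (s z i) then ennreal (l i / ?L) *
       (\<integral>\<^sup>+x. capped_hitting_time V s f m (s z i) x \<partial>arrival_measure V l) else 0)"
  proof (intro add_left_mono sum_mono)
    fix i assume i: "i \<in> V"
    have p: "0 \<le> l i / ?L" using l[OF i] L by simp
    show "\<kappa> * ennreal (b i) \<le> (if 0 < f (s z i) then ennreal (l i / ?L) *
       (\<integral>\<^sup>+x. capped_hitting_time V s f m (s z i) x \<partial>arrival_measure V l) else 0)"
    proof (cases "0 < f (s z i)")
      case True
      then have "0 \<le> (\<Sum>k<m. f (s z i) / (f (s z i) + real k))" by (intro sum_nonneg) auto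
      then have "\<kappa> * ennreal (b i) = ennreal (l i / ?L) * (\<kappa> * ennreal (\<Sum>k<m. f (s z i) / (f (s z i) + real k)))"
        using True p by (simp add: b_def ennreal_mult mult_ac del: times_divide_eq_left)
      with True show ?thesis by (simp add: mult_left_mono IH i del: times_divide_eq_left)
    qed (simp add: b_def)
  qed
  also have "\<dots> = (\<integral>\<^sup>+x. capped_hitting_time V s f (Suc m) z x \<partial>arrival_measure V l)"
    unfolding \<kappa>_def by (rule nn_integral_capped_hitting_time_Suc[symmetric])
  finally show ?thesis .
qed

lemma mean_capped_hitting_time_ge:
  assumes "z \<in> S" "0 < f z"
  shows "(\<integral>\<^sup>+x. ennreal (MIN i\<in>V. x (i, 0)) \<partial>arrival_measure V l) * ennreal (\<Sum>k<m. f z / (f z + real k))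
    \<le> (\<integral>\<^sup>+x. capped_hitting_time V s f m z x \<partial>arrival_measure V l)"
  using assms
proof (induction m arbitrary: z)
  case 0
  then show ?case by simp
next
  case (Suc m)
  \<comment> \<open>The term for \<open>k = 0\<close> is \<open>f z / f z\<close>, which is 1
    because \<open>f z\<close> is positive.\<close>
  have "(\<Sum>k<Suc m. f z / (f z + real k)) = 1 + (\<Sum>k<m. f z / (f z + (real k + 1)))"
    using Suc.prems by (subst sum.lessThan_Suc_shift) (simp add: add_ac)
  then show ?case
    using mean_capped_hitting_time_ge_step[of z "f z" m] Suc drift S by simp
qed

lemma mean_min_pos: "0 < (\<integral>\<^sup>+x. ennreal (MIN i\<in>V. x (i, 0)) \<partial>arrival_measure V l)"
proof (rule ccontr)
  let ?P = "arrival_measure V l"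
  assume "\<not> ?thesis"
  then have "(\<integral>\<^sup>+x. ennreal (MIN i\<in>V. x (i, 0)) \<partial>?P) = 0" by simp
  moreover have "(\<lambda>x. ennreal (MIN i\<in>V. x (i, 0))) \<in> borel_measurable ?P"
    using V by (intro measurable_compose[OF _ measurable_ennreal] borel_measurable_Min measurable_coord)
  ultimately have "AE x in ?P. ennreal (MIN i\<in>V. x (i, 0)) = 0"
    by (simp add: nn_integral_0_iff_AE)
  moreover have "AE x in ?P. \<forall>i\<in>V. 0 < x (i, 0)"
    using AE_arrivals_pos by eventually_elim blast
  ultimately have "AE x in ?P. False"
    by eventually_elim (use V in \<open>auto simp: ennreal_eq_0_iff Min_le_iff\<close>)
  then show False by simp
qed

text \<open>At \<open>f z = 0\<close> the ratio \<open>f z / (f z + k)\<close> says nothing. The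
  positive mean \<open>d\<close> of \<open>f\<close> after one arrival takes the place of the
  numerator and leaves a multiple of the harmonic series.\<close>

lemma mean_capped_hitting_time_unbounded:
  assumes z: "z \<in> S" "f z = 0" "0 < (\<Sum>i\<in>V. l i * f (s z i))"
  shows "(SUP m. (\<integral>\<^sup>+x. capped_hitting_time V s f m z x \<partial>arrival_measure V l)) = \<infinity>"
proof -
  let ?P = "arrival_measure V l" and ?L = "\<Sum>j\<in>V. l j"
  let ?\<kappa> = "(\<integral>\<^sup>+x. ennreal (MIN i\<in>V. x (i, 0)) \<partial>?P)"
  have L: "0 < ?L" using V l by (intro sum_pos) auto
  define d where "d = (\<Sum>i\<in>V. l i * f (s z i)) / ?L"
  have d: "0 < d" using z L by (simp add: d_def)
  have "(\<Sum>i\<in>V. l i * d) = (\<Sum>i\<in>V. l i * f (s z i))" using L unfolding sum_distrib_right[symmetric] by (simp add: d_def)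
  then have step: "?\<kappa> * ennreal (1 + (\<Sum>k<m. d / (real k + 1))) \<le> (\<integral>\<^sup>+x. capped_hitting_time V s f (Suc m) z x \<partial>?P)" for m
    using mean_capped_hitting_time_ge_step[of z d m] mean_capped_hitting_time_ge z S by simp
  have sup: "(SUP m. ennreal (1 + (\<Sum>k<m. d / (real k + 1)))) = \<infinity>"
    unfolding infinity_ennreal_def
  proof (rule ennreal_SUP_eq_top)
    fix n :: nat
    have "\<not> summable (\<lambda>k. d / (real k + 1))"
    proof
      assume "summable (\<lambda>k. d / (real k + 1))"
      then have "summable (\<lambda>k. 1 / d * (d / (real k + 1)))" by (rule summable_mult)
      then have "summable (\<lambda>k. inverse (real (Suc k)))" using d by (simp add: inverse_eq_divide add.commute)
      then show False using not_summable_harmonic[where 'a=real] summable_Suc_iff[of "\<lambda>k. inverse (real k)"]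
        by (simp add: inverse_eq_divide)
    qed
    then have "\<not> (\<forall>m. (\<Sum>k<m. d / (real k + 1)) \<le> n)"
      using d by (metis bounded_imp_summable divide_nonneg_nonneg less_imp_le of_nat_0_le_iff add_nonneg_nonneg zero_le_one lessThan_Suc_atMost)
    then obtain m where "n < (\<Sum>k<m. d / (real k + 1))" by (auto simp: not_le)
    then show "\<exists>m\<in>UNIV. of_nat n \<le> ennreal (1 + (\<Sum>k<m. d / (real k + 1)))"
      unfolding ennreal_of_nat_eq_real_of_nat by (intro bexI[of _ m] ennreal_leI) auto
  qed
  \<comment> \<open>In \<open>ennreal\<close> the product of 0 and \<open>\<infinity>\<close> is 0,
    hence the appeal to \<open>mean_min_pos\<close>.\<close>
  have "\<infinity> = ?\<kappa> * (SUP m. ennreal (1 + (\<Sum>k<m. d / (real k + 1))))"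
    unfolding sup using mean_min_pos by (simp add: ennreal_mult_top)
  also have "\<dots> = (SUP m. ?\<kappa> * ennreal (1 + (\<Sum>k<m. d / (real k + 1))))"
    by (rule SUP_mult_left_ennreal)
  also have "\<dots> \<le> (SUP m. (\<integral>\<^sup>+x. capped_hitting_time V s f m z x \<partial>?P))"
    by (rule SUP_mono) (use step in blast)
  finally show ?thesis by (simp add: top_unique)
qed

end

section \<open>Almost sure regularity of the arrivals\<close>

text \<open>The probability that \<open>m\<close> consecutive gaps are all at most 1 is
  \<open>p ^ m\<close> with \<open>p < 1\<close>, and this tends to 0.\<close>

lemma AE_arrivals_infinitely_often:
  assumes i: "i \<in> V"
  shows "AE x in arrival_measure V l. \<forall>n. \<exists>k\<ge>n. 1 < x (i, k)"
proof -
  let ?P = "arrival_measure V l"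
  define p where "p = measure (expo (l i)) {..1}"
  interpret E: prob_space "expo (l i)" using l i by (intro prob_space_exponential_density)
  have p: "p < 1"
  proof -
    have "distributed (expo (l i)) lborel (\<lambda>x. x) (exponential_density (l i))"
      by (auto simp: distributed_def distr_id2)
    from E.exponential_distributedD_le[OF this, of 1] l[OF i] show ?thesis
      by (simp add: p_def atMost_def)
  qed
  have "AE x in ?P. \<exists>k\<ge>n. 1 < x (i, k)" for n
  proof -
    let ?A = "\<lambda>m. {x\<in>space ?P. \<forall>a\<in>Pair i ` {n..<n+m}. x a \<in> {..1}}"
    \<comment> \<open>\<open>product_prob_space\<close> asks for a probability measure at every
      index, so classes outside \<open>V\<close> receive the rate 1.\<close>
    have "prob_space (case a of (j, k :: nat) \<Rightarrow> expo (if j \<in> V then l j else 1))" for a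
      by (cases a) (simp add: prob_space_exponential_density l)
    then interpret pp: product_prob_space "\<lambda>(j, k :: nat). expo (if j \<in> V then l j else 1)" "V \<times> UNIV"
      by (rule product_prob_spaceI)
    have P: "Pi\<^sub>M (V \<times> UNIV) (\<lambda>(j, k :: nat). expo (if j \<in> V then l j else 1)) = ?P"
      by (intro PiM_cong) auto
    have A: "emeasure ?P (?A m) = ennreal (p ^ m)" for m
    proof -
      have "emeasure ?P (?A m) = (\<Prod>a\<in>Pair i ` {n..<n+m}. emeasure (case a of (j, k) \<Rightarrow> expo (if j \<in> V then l j else 1)) {..1})"
        unfolding P[symmetric] using i by (intro pp.emeasure_PiM_Collect) (auto split: prod.splits)
      also have "\<dots> = (\<Prod>k\<in>{n..<n+m}. emeasure (expo (l i)) {..1})"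
        using i by (subst prod.reindex) (auto simp: inj_on_def)
      also have "\<dots> = ennreal (p ^ m)"
        by (simp add: E.emeasure_eq_measure p_def ennreal_power)
      finally show ?thesis .
    qed
    let ?B = "{x\<in>space ?P. \<forall>k\<ge>n. x (i, k) \<le> 1}"
    have B: "?B \<in> sets ?P"
    proof -
      have [measurable]: "(\<lambda>x. x (i, k)) \<in> borel_measurable ?P" for k using i by (rule measurable_coord)
      show ?thesis by measurable
    qed
    have "emeasure ?P ?B \<le> ennreal (p ^ m)" for m
    proof -
      have [measurable]: "(\<lambda>x. x (i, k)) \<in> borel_measurable ?P" for k using i by (rule measurable_coord)
      have eq: "?A m = {x\<in>space ?P. \<forall>k\<in>{n..<n+m}. x (i, k) \<le> 1}" by auto
      have "?A m \<in> sets ?P" unfolding eq by measurable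
      then have "emeasure ?P ?B \<le> emeasure ?P (?A m)" by (intro emeasure_mono) auto
      then show ?thesis unfolding A .
    qed
    moreover have "(\<lambda>m. ennreal (p ^ m)) \<longlonglongrightarrow> ennreal 0"
      using p by (intro tendsto_ennrealI LIMSEQ_realpow_zero) (auto simp: p_def)
    ultimately have "emeasure ?P ?B \<le> 0"
      by (intro LIMSEQ_le_const[of "\<lambda>m. ennreal (p ^ m)"]) auto
    then have "emeasure ?P ?B = 0" by simp
    then show ?thesis
      by (intro AE_I[of _ _ ?B]) (auto simp: not_less B)
  qed
  then show ?thesis by (simp add: AE_all_countable)
qed

lemma AE_regular: "AE x in arrival_measure V l. regular V x"
proof -
  have "AE x in arrival_measure V l. \<forall>i\<in>V. \<forall>n. \<exists>k\<ge>n. 1 < x (i, k)"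
    using V AE_arrivals_infinitely_often by (simp add: AE_finite_all)
  with AE_arrivals_pos show ?thesis
  proof eventually_elim
    case (elim x)
    have "finite {k. epoch x i k \<le> t}" if i: "i \<in> V" for i t
    proof -
      have mono: "epoch x i k \<le> epoch x i k'" if "k \<le> k'" for k k'
        unfolding epoch_def using that elim(1) i by (intro sum_mono2) (auto intro: less_imp_le)
      \<comment> \<open>Every gap longer than 1 lifts the epochs by a further unit, and such gaps
        never cease.\<close>
      have "\<exists>k. real m \<le> epoch x i k" for m
      proof (induction m)
        case 0
        have "0 \<le> epoch x i 0" using elim(1) i by (simp add: epoch_def less_imp_le)
        then show ?case by auto
      next
        case (Suc m)
        then obtain k where k: "real m \<le> epoch x i k" by blast
        obtain k' where k': "k' \<ge> Suc k" "1 < x (i, k')" using elim(2) i by blast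
        then obtain k'' where k'': "k' = Suc k''" "k \<le> k''" by (cases k') auto
        have "epoch x i k' = epoch x i k'' + x (i, k')" unfolding k'' by (simp add: epoch_def)
        with mono[OF k''(2)] k k'(2) show ?case by (intro exI[of _ k']) auto
      qed
      then obtain k where k: "real (nat \<lceil>t\<rceil> + 1) \<le> epoch x i k" by blast
      have "{k. epoch x i k \<le> t} \<subseteq> {..<k}"
      proof
        fix j assume "j \<in> {k. epoch x i k \<le> t}"
        then have "epoch x i j < epoch x i k" using k by simp linarith
        then show "j \<in> {..<k}" using mono[of k j] by (auto simp: not_le[symmetric])
      qed
      then show ?thesis by (rule finite_subset) simp
    qed
    with elim show ?case by (auto simp: regular_def less_imp_le)
  qed
qed

end

section \<open>From the arrival process to the queue\<close>

lemma (in prob_space) AE_pair_snd: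
  assumes "prob_space N" and "AE y in N. P y"
  shows "AE p in M \<Otimes>\<^sub>M N. P (snd p)"
proof -
  interpret N: prob_space N by fact
  obtain A where A: "{y \<in> space N. \<not> P y} \<subseteq> A" "emeasure N A = 0" "A \<in> sets N"
    using assms(2) by (rule AE_E)
  have "emeasure (M \<Otimes>\<^sub>M N) (space M \<times> A) = 0"
    using A by (simp add: N.emeasure_pair_measure_Times)
  with A show ?thesis
    by (intro AE_I[of _ _ "space M \<times> A"]) (auto simp: space_pair_measure)
qed

text \<open>Allows the almost sure values of the single decision coordinates to be combined over all
  states.\<close>

lemma countable_queue_states:
  assumes "finite (pverts G)"
  shows "countable (queue_states G)"
proof (rule countable_subset)
  show "queue_states G \<subseteq> (\<lambda>g i. if i \<in> pverts G then g i else 0) ` (pverts G \<rightarrow>\<^sub>E (UNIV :: nat set))"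
  proof
    fix z assume "z \<in> queue_states G"
    then have "z = (\<lambda>i. if i \<in> pverts G then restrict z (pverts G) i else 0)"
      by (auto simp: queue_states_def)
    then show "z \<in> (\<lambda>g i. if i \<in> pverts G then g i else 0) ` (pverts G \<rightarrow>\<^sub>E (UNIV :: nat set))"
      by (intro image_eqI[of _ _ "restrict z (pverts G)"]) auto
  qed
  show "countable ((\<lambda>g i. if i \<in> pverts G then g i else 0) ` (pverts G \<rightarrow>\<^sub>E (UNIV :: nat set)))"
    using assms by (intro countable_image countable_PiE) auto
qed

lemma queue_statesI:
  assumes "\<And>i. i \<notin> pverts G \<Longrightarrow> z i = 0" "\<And>i j. (i, j) \<in> parcs G \<Longrightarrow> z i * z j = 0"
  shows "z \<in> queue_states G"
  using assms unfolding queue_states_def by blast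

lemma arrive_queue_states:
  assumes G: "pair_graph G" and z: "z \<in> queue_states G" and i: "i \<in> pverts G"
    and j: "available G z i \<noteq> {} \<Longrightarrow> j \<in> available G z i"
  shows "arrive G z i j \<in> queue_states G"
proof -
  interpret pair_graph G by fact
  show ?thesis
  proof (cases "available G z i = {}")
    case True
    have sym: "(a, b) \<in> parcs G \<Longrightarrow> (b, a) \<in> parcs G" for a b
      using pair_sym_arcs by (auto simp: symmetric_def sym_def arcs_ends_def)
    have nz: "z a = 0" if "(i, a) \<in> parcs G" for a
      using True that by (auto simp: available_def neighbours_def)
    have "(z(i := z i + 1)) a * (z(i := z i + 1)) b = 0" if ab: "(a, b) \<in> parcs G" for a b
      using z ab nz[of a] nz[of b] sym[OF ab] pair_no_loops[OF ab]
      by (auto simp: queue_states_def)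
    from this have "z(i := z i + 1) \<in> queue_states G"
      by (intro queue_statesI) (use z i in \<open>auto simp: queue_states_def\<close>)
    with True show ?thesis by (simp add: arrive_def)
  next
    case False
    have "(z(j := z j - 1)) a * (z(j := z j - 1)) b = 0" if ab: "(a, b) \<in> parcs G" for a b
      using z ab by (auto simp: queue_states_def)
    then have "z(j := z j - 1) \<in> queue_states G"
      by (intro queue_statesI) (use z in \<open>auto simp: queue_states_def\<close>)
    with False show ?thesis by (simp add: arrive_def)
  qed
qed

text \<open>A return to \<open>z\<close> brings \<open>f\<close> back to \<open>f z\<close>, which
  is nonpositive, and having left \<open>z\<close> before takes at least one arrival. So
  \<open>capped_hitting_time_le\<close> applies to every time in the infimum.\<close>

lemma return_time_ge:
  assumes G: "finite (pverts G)" "pverts G \<noteq> {}"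
    and x: "regular (pverts G) (fst \<omega>)" "\<And>i k. i \<in> pverts G \<Longrightarrow> 0 < fst \<omega> (i, k)"
    and run: "\<And>n. queue_after G z n \<omega> = run G s (fst \<omega>) z n" and f: "f z \<le> 0"
  shows "capped_hitting_time (pverts G) s f m z (fst \<omega>) \<le> return_time (\<lambda>t. queue_process G z t \<omega>)"
  unfolding return_time_def
proof (rule Inf_greatest, clarify)
  fix t u :: real
  let ?x = "fst \<omega>"
  let ?N = "total_count (pverts G) ?x"
  assume t: "queue_process G z t \<omega> = queue_process G z 0 \<omega>"
    and u: "0 \<le> u" "u < t" "queue_process G z u \<omega> \<noteq> queue_process G z 0 \<omega>"
  have proc: "queue_process G z t \<omega> = run G s ?x z (?N t)" for t
    by (simp add: queue_process_def total_count_def run)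
  \<comment> \<open>As gaps are positive, nothing arrives at time 0 and the process is still at
    \<open>z\<close> then.\<close>
  have "0 < epoch ?x i k" if "i \<in> pverts G" for i k
    unfolding epoch_def using x(2) that by (intro sum_pos) auto
  then have "{k. epoch ?x i k \<le> 0} = {}" if "i \<in> pverts G" for i
    using that by (auto simp: not_le)
  then have "?N 0 = 0"
    by (simp add: total_count_def poisson_count_def)
  then have start: "queue_process G z 0 \<omega> = z" by (simp add: proc)
  have "?N u \<noteq> 0"
  proof
    assume "?N u = 0"
    then have "queue_process G z u \<omega> = z" by (simp add: proc)
    with u start show False by simp
  qed
  moreover have "?N u \<le> ?N t"
    unfolding total_count_def poisson_count_def
    using u x(1) by (intro sum_mono card_mono) (auto simp: regular_def)
  ultimately have "?N t \<noteq> 0" by simp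
  moreover have "f (run G s ?x z (?N t)) \<le> 0"
    using t start f by (simp add: proc)
  ultimately show "capped_hitting_time (pverts G) s f m z ?x \<le> ennreal t"
    using capped_hitting_time_le[OF refl G x(1)] by blast
qed

text \<open>The decisions of a deterministic policy are almost surely the prescribed ones, so the
  path depends on the gaps alone. The mean return time of the empty queue then dominates the mean
  capped hitting time for every cap \<open>m\<close>.\<close>

lemma not_stable:
  fixes G :: "'v pair_pre_digraph" and f :: "('v \<Rightarrow> nat) \<Rightarrow> real"
    and pol :: "('v \<Rightarrow> nat) \<Rightarrow> 'v \<Rightarrow> 'v"
  defines "step \<equiv> \<lambda>z i. arrive G z i (pol z i)"
  assumes G: "pair_graph G" and l: "\<And>i. i \<in> pverts G \<Longrightarrow> 0 < l i"
    and adm: "admissible G (\<lambda>z i. return_pmf (pol z i))"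
    and incr: "\<And>z i. z \<in> queue_states G \<Longrightarrow> i \<in> pverts G \<Longrightarrow> f (step z i) \<le> f z + 1"
    and drift: "\<And>z. z \<in> queue_states G \<Longrightarrow> 0 < f z \<Longrightarrow>
      (\<Sum>i\<in>pverts G. l i * f z) \<le> (\<Sum>i\<in>pverts G. l i * f (step z i))"
    and zero: "f (\<lambda>_. 0) = 0" "0 < (\<Sum>i\<in>pverts G. l i * f (step (\<lambda>_. 0) i))"
  shows "\<not> stable G l (\<lambda>z i. return_pmf (pol z i))"
proof -
  interpret pair_graph G by fact
  let ?V = "pverts G" and ?z = "\<lambda>_ :: 'v. 0 :: nat" and ?S = "queue_states G"
  let ?A = "arrival_measure ?V l"
  let ?D = "\<Pi>\<^sub>M (n :: nat, z, i)\<in>UNIV \<times> ?S \<times> ?V. measure_pmf (return_pmf (pol z i))"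
  have V: "finite ?V" "?V \<noteq> {}" using zero by auto
  have z: "?z \<in> ?S" by (auto simp: queue_states_def)
  have step: "step z i \<in> ?S" if "z \<in> ?S" "i \<in> ?V" for z i
    unfolding step_def using G that adm by (intro arrive_queue_states) (auto simp: admissible_def)
  interpret A: prob_space ?A using V(1) l by (rule prob_space_arrivals)
  interpret D: prob_space ?D
    by (intro prob_space_PiM) (auto intro: measure_pmf.prob_space_axioms)
  interpret AD: pair_prob_space ?A ?D ..
  have Q: "queue_space G l (\<lambda>z i. return_pmf (pol z i)) = ?A \<Otimes>\<^sub>M ?D"
    by (simp add: queue_space_def)
  have "AE d in ?D. \<forall>n. \<forall>z\<in>?S. \<forall>i\<in>?V. d (n, z, i) = pol z i"
  proof -
    have "AE d in ?D. d (n, z, i) = pol z i" if "z \<in> ?S" "i \<in> ?V" for n z i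
      using that by (intro AE_PiM_component) (auto intro: measure_pmf.prob_space_axioms simp: AE_measure_pmf_iff)
    then show ?thesis
      using V by (simp add: AE_all_countable AE_finite_all AE_ball_countable countable_queue_states)
  qed
  then have "AE \<omega> in ?A \<Otimes>\<^sub>M ?D. \<forall>n. \<forall>z\<in>?S. \<forall>i\<in>?V. snd \<omega> (n, z, i) = pol z i"
    by (rule A.AE_pair_snd[OF D.prob_space_axioms])
  moreover have "AE x in ?A. regular ?V x \<and> (\<forall>i\<in>?V. \<forall>k. 0 < x (i, k))"
    using AE_regular[OF V l] AE_arrivals_pos[OF V l] by simp
  then have "AE \<omega> in ?A \<Otimes>\<^sub>M ?D. regular ?V (fst \<omega>) \<and> (\<forall>i\<in>?V. \<forall>k. 0 < fst \<omega> (i, k))"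
    by (intro AE_distrD[where M="?A \<Otimes>\<^sub>M ?D" and M'="?A" and f=fst]) (simp_all only: D.distr_pair_fst measurable_fst)
  ultimately have AE: "AE \<omega> in ?A \<Otimes>\<^sub>M ?D. capped_hitting_time ?V step f m ?z (fst \<omega>)
      \<le> return_time (\<lambda>t. queue_process G ?z t \<omega>)" for m
  proof eventually_elim
    case (elim \<omega>)
    have "queue_after G ?z n \<omega> = run G step (fst \<omega>) ?z n \<and> run G step (fst \<omega>) ?z n \<in> ?S" for n
    proof (induction n)
      case 0
      then show ?case using z by simp
    next
      case (Suc n)
      have "arrival_class G (fst \<omega>) n \<in> ?V"
        unfolding arrival_class_def using arg_min_if_finite(1)[OF V] .
      then show ?case using Suc elim(1) step by (simp add: Let_def step_def)
    qed
    then show ?case using elim(2) V zero by (intro return_time_ge) auto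
  qed
  have "(\<integral>\<^sup>+x. capped_hitting_time ?V step f m ?z x \<partial>?A) \<le>
      (\<integral>\<^sup>+\<omega>. return_time (\<lambda>t. queue_process G ?z t \<omega>) \<partial>(?A \<Otimes>\<^sub>M ?D))" for m
  proof -
    have "(\<integral>\<^sup>+x. capped_hitting_time ?V step f m ?z x \<partial>?A) =
        (\<integral>\<^sup>+x. capped_hitting_time ?V step f m ?z x \<partial>distr (?A \<Otimes>\<^sub>M ?D) ?A fst)"
      by (simp only: D.distr_pair_fst)
    also have "\<dots> = (\<integral>\<^sup>+\<omega>. capped_hitting_time ?V step f m ?z (fst \<omega>) \<partial>(?A \<Otimes>\<^sub>M ?D))"
      using V by (intro nn_integral_distr measurable_capped_hitting_time) auto
    also have "\<dots> \<le> (\<integral>\<^sup>+\<omega>. return_time (\<lambda>t. queue_process G ?z t \<omega>) \<partial>(?A \<Otimes>\<^sub>M ?D))"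
      using AE by (rule nn_integral_mono_AE)
    finally show ?thesis .
  qed
  then have "(SUP m. (\<integral>\<^sup>+x. capped_hitting_time ?V step f m ?z x \<partial>?A)) \<le>
      (\<integral>\<^sup>+\<omega>. return_time (\<lambda>t. queue_process G ?z t \<omega>) \<partial>(?A \<Otimes>\<^sub>M ?D))"
    by (rule SUP_least)
  moreover have "(SUP m. (\<integral>\<^sup>+x. capped_hitting_time ?V step f m ?z x \<partial>?A)) = \<infinity>"
    using step incr drift z zero by (intro mean_capped_hitting_time_unbounded[OF V l]) auto
  ultimately have "(\<integral>\<^sup>+\<omega>. return_time (\<lambda>t. queue_process G ?z t \<omega>) \<partial>(?A \<Otimes>\<^sub>M ?D)) = \<infinity>"
    by (simp add: top_unique)
  then show ?thesis
    using z by (auto simp: stable_def positive_recurrent_def Q intro!: bexI[of _ ?z])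
qed

section \<open>Triangles and odd cycles\<close>

lemma graph_sym:
  assumes "pair_graph G" "(u, v) \<in> parcs G"
  shows "(v, u) \<in> parcs G"
proof -
  interpret pair_graph G by fact
  show ?thesis using pair_sym_arcs assms(2) by (auto simp: symmetric_def dest: symD)
qed

lemma graph_irrefl:
  assumes "pair_graph G"
  shows "(v, v) \<notin> parcs G"
proof -
  interpret pair_graph G by fact
  show ?thesis using pair_no_loops[of "(v, v)"] by auto
qed

lemma graph_verts:
  assumes "pair_graph G" "(u, v) \<in> parcs G"
  shows "u \<in> pverts G" "v \<in> pverts G"
proof -
  interpret pair_graph G by fact
  show "u \<in> pverts G" "v \<in> pverts G" using in_arcsD1 in_arcsD2 assms(2) by auto
qed

lemma connected_graph_rtrancl:
  assumes G: "G \<in> connected_graphs" and uv: "u \<in> pverts G" "v \<in> pverts G"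
  shows "(u, v) \<in> (parcs G)\<^sup>*"
proof -
  interpret pair_graph G using G by (simp add: connected_graphs_def)
  have "u \<rightarrow>\<^sup>*\<^bsub>mk_symmetric G\<^esub> v"
    using G uv by (auto simp: connected_graphs_def Digraph_Component.connected_def strongly_connected_def)
  then have "u \<rightarrow>\<^sup>*\<^bsub>with_proj G\<^esub> v"
    using reachable_mk_symmetric_eq[OF pair_sym_arcs] by simp
  then have "(u, v) \<in> rtrancl_on (pverts G) (parcs G)" by (simp add: reachable_def)
  then show ?thesis by (induction) (auto intro: rtrancl.rtrancl_into_rtrancl)
qed

lemma connected_graph_closed_subset:
  assumes G: "G \<in> connected_graphs" and Y: "Y \<noteq> {}" "Y \<subseteq> pverts G"
    and closed: "\<And>u v. u \<in> Y \<Longrightarrow> (u, v) \<in> parcs G \<Longrightarrow> v \<in> Y"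
  shows "Y = pverts G"
proof -
  obtain u where u: "u \<in> Y" using Y by auto
  have "v \<in> Y" if "v \<in> pverts G" for v
  proof -
    have "(u, v) \<in> (parcs G)\<^sup>*" using connected_graph_rtrancl[OF G, of u v] u Y that by auto
    then show ?thesis using u closed by (induction) auto
  qed
  with Y show ?thesis by auto
qed

section \<open>Induced subgraphs as embeddings\<close>

text \<open>A form of \<open>induces\<close> without the intermediate subgraph. The map goes from
  \<open>H\<close> into \<open>G\<close>, opposite to the isomorphism in
  \<open>induces\<close>.\<close>

definition embeds :: "'w pair_pre_digraph \<Rightarrow> 'v pair_pre_digraph \<Rightarrow> ('w \<Rightarrow> 'v) \<Rightarrow> bool" where
  "embeds H G \<phi> \<longleftrightarrow> inj_on \<phi> (pverts H) \<and> \<phi> ` pverts H \<subseteq> pverts G \<and>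
     (\<forall>u\<in>pverts H. \<forall>v\<in>pverts H. (\<phi> u, \<phi> v) \<in> parcs G \<longleftrightarrow> (u, v) \<in> parcs H)"

lemma induces_imp_embeds:
  assumes "induces G H"
  shows "\<exists>\<phi>. embeds H G \<phi>"
proof -
  from assms obtain K hom where K: "induced_subgraph (with_proj K) (with_proj G)"
    and hom: "pre_digraph.digraph_isomorphism (with_proj K) hom" "with_proj H = app_iso hom (with_proj K)"
    by (auto simp: induces_def digraph_iso_def)
  let ?h = "iso_verts hom"
  have KV: "pverts K \<subseteq> pverts G" and KE: "parcs K = {e \<in> parcs G. fst e \<in> pverts K \<and> snd e \<in> pverts K}"
    using K by (auto simp: induced_subgraph_def subgraph_def)
  have inj: "inj_on ?h (pverts K)"
    and arcs: "\<And>a. a \<in> parcs K \<Longrightarrow> ?h (fst a) = iso_tail hom (iso_arcs hom a) \<and> ?h (snd a) = iso_head hom (iso_arcs hom a)"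
    using hom(1) by (auto simp: pre_digraph.digraph_isomorphism_def)
  have HV: "pverts H = ?h ` pverts K" and HE: "parcs H = iso_arcs hom ` parcs K"
    and th: "iso_tail hom = fst" "iso_head hom = snd"
    using arg_cong[OF hom(2), of verts] arg_cong[OF hom(2), of pre_digraph.arcs]
      arg_cong[OF hom(2), of tail] arg_cong[OF hom(2), of head] by simp_all
  have "iso_arcs hom a = (?h (fst a), ?h (snd a))" if "a \<in> parcs K" for a
    using arcs[OF that] th by (simp add: prod_eq_iff)
  then have HE': "parcs H = (\<lambda>a. (?h (fst a), ?h (snd a))) ` parcs K"
    unfolding HE by (rule image_cong[OF refl])
  let ?g = "inv_into (pverts K) ?h"
  have g: "?g (?h u) = u" if "u \<in> pverts K" for u using inj that by simp
  have "(u, v) \<in> parcs G \<longleftrightarrow> (?h u, ?h v) \<in> parcs H" if "u \<in> pverts K" "v \<in> pverts K" for u v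
  proof
    assume "(u, v) \<in> parcs G"
    then have "(u, v) \<in> parcs K" using that KE by auto
    then show "(?h u, ?h v) \<in> parcs H" unfolding HE' by force
  next
    assume "(?h u, ?h v) \<in> parcs H"
    then obtain a where a: "a \<in> parcs K" "?h u = ?h (fst a)" "?h v = ?h (snd a)" unfolding HE' by auto
    then have "a = (u, v)" using inj that KE by (auto simp: prod_eq_iff dest: inj_onD)
    then show "(u, v) \<in> parcs G" using a KE by auto
  qed
  then have "embeds H G ?g" unfolding embeds_def HV
    using KV by (auto simp: g intro: inj_on_inv_into)
  then show ?thesis by blast
qed

lemma embeds_imp_induces:
  fixes G :: "'v pair_pre_digraph" and H :: "'w pair_pre_digraph"
  assumes G: "pair_graph G" and H: "parcs H \<subseteq> pverts H \<times> pverts H" and \<phi>: "embeds H G \<phi>"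
  shows "induces G H"
proof -
  interpret pair_graph G by fact
  define K where "K = \<lparr>pverts = \<phi> ` pverts H, parcs = {e \<in> parcs G. fst e \<in> \<phi> ` pverts H \<and> snd e \<in> \<phi> ` pverts H}\<rparr>"
  let ?g = "inv_into (pverts H) \<phi>"
  define hom where "hom = \<lparr>iso_verts = ?g, iso_arcs = map_prod ?g ?g, iso_head = snd, iso_tail = fst\<rparr>"
  have inj: "inj_on \<phi> (pverts H)" and sub: "\<phi> ` pverts H \<subseteq> pverts G"
    and adj: "\<And>u v. u \<in> pverts H \<Longrightarrow> v \<in> pverts H \<Longrightarrow> (\<phi> u, \<phi> v) \<in> parcs G \<longleftrightarrow> (u, v) \<in> parcs H"
    using \<phi> by (auto simp: embeds_def)
  interpret K: pair_wf_digraph K by unfold_locales (auto simp: K_def)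
  have "induced_subgraph (with_proj K) (with_proj G)"
    using sub K.wf_digraph_axioms wf_digraph_axioms
    by (auto simp: induced_subgraph_def subgraph_def compatible_def K_def)
  moreover have "pre_digraph.digraph_isomorphism (with_proj K) hom"
    unfolding pre_digraph.digraph_isomorphism_def
  proof (intro conjI ballI)
    show "wf_digraph (with_proj K)" by (rule K.wf_digraph_axioms)
    show "inj_on (iso_verts hom) (verts (with_proj K))"
      using inj by (auto simp: hom_def K_def inj_on_inv_into)
    show "inj_on (iso_arcs hom) (arcs (with_proj K))"
    proof -
      have "inj_on (map_prod ?g ?g) (\<phi> ` pverts H \<times> \<phi> ` pverts H)"
        by (intro map_prod_inj_on inj_on_inv_into) auto
      then have "inj_on (map_prod ?g ?g) (parcs K)" by (rule inj_on_subset) (auto simp: K_def)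
      then show ?thesis by (simp add: hom_def)
    qed
  qed (auto simp: hom_def)
  moreover have "with_proj H = app_iso hom (with_proj K)"
  proof -
    have "?g ` \<phi> ` pverts H = pverts H" using inj by (auto simp: image_image)
    moreover have "parcs H = map_prod ?g ?g ` parcs K"
    proof (intro set_eqI iffI)
      fix e assume e: "e \<in> parcs H"
      obtain u v where uv: "e = (u, v)" "u \<in> pverts H" "v \<in> pverts H" using e H by auto
      then have "(\<phi> u, \<phi> v) \<in> parcs K" using adj e by (auto simp: K_def)
      then show "e \<in> map_prod ?g ?g ` parcs K" using uv inj by (intro image_eqI[of _ _ "(\<phi> u, \<phi> v)"]) auto
    next
      fix e assume "e \<in> map_prod ?g ?g ` parcs K"
      then show "e \<in> parcs H" using inj adj by (auto simp: K_def)
    qed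
    ultimately show ?thesis by (simp add: with_proj_def app_iso_def hom_def K_def)
  qed
  ultimately show ?thesis unfolding induces_def digraph_iso_def by blast
qed

section \<open>Bipartite graphs and odd closed walks\<close>

definition bipartite :: "'v pair_pre_digraph \<Rightarrow> bool" where
  "bipartite G \<longleftrightarrow> (\<exists>A B. A \<union> B = pverts G \<and> A \<inter> B = {} \<and>
     neighbours G A \<subseteq> B \<and> neighbours G B \<subseteq> A)"

text \<open>Each nonempty side is independent with all its neighbours on the other side, so its rate
  would be strictly below that of the other side. This cannot hold both ways, nor against an empty
  side.\<close>

lemma bipartite_imp_Ncond_empty:
  assumes G: "pair_graph G" "pverts G \<noteq> {}" and bip: "bipartite G"
  shows "Ncond G = {}"
proof (rule ccontr)
  interpret pair_graph G by fact
  assume "Ncond G \<noteq> {}"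
  then obtain l where l: "l \<in> Ncond G" by blast
  from bip obtain A B where AB: "A \<union> B = pverts G" "A \<inter> B = {}" "neighbours G A \<subseteq> B" "neighbours G B \<subseteq> A"
    by (auto simp: bipartite_def)
  have fin: "finite A" "finite B" using AB(1) pair_finite_verts by (auto intro: finite_subset)
  have pos: "0 < l v" if "v \<in> pverts G" for v
    using l that by (auto simp: Ncond_def PiE_iff)
  have less: "sum l I < sum l J" if "I \<noteq> {}" "I \<subseteq> pverts G" "I \<inter> J = {}" "neighbours G I \<subseteq> J" "J \<subseteq> pverts G" for I J
  proof -
    have "independent_set G I" using that by (auto simp: independent_set_def neighbours_def)
    then have "sum l I < sum l (neighbours G I)" using l by (auto simp: Ncond_def)
    also have "\<dots> \<le> sum l J"
      using that by (intro sum_mono2) (auto intro!: less_imp_le[OF pos] finite_subset[OF _ pair_finite_verts])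
    finally show ?thesis .
  qed
  have A: "sum l A < sum l B" if "A \<noteq> {}" using AB that by (intro less) auto
  have B: "sum l B < sum l A" if "B \<noteq> {}" using AB that by (intro less) auto
  have "0 \<le> sum l A" "0 \<le> sum l B" using AB(1) by (auto intro!: sum_nonneg less_imp_le[OF pos])
  moreover have "A \<noteq> {} \<or> B \<noteq> {}" using G AB by auto
  ultimately show False using A B by fastforce
qed

text \<open>The sides are the vertices reached from a root \<open>r\<close> by walks of even and of
  odd length. A vertex in both would close an odd walk at \<open>r\<close>.\<close>

lemma no_odd_closed_walk_imp_bipartite:
  assumes G: "G \<in> connected_graphs"
    and no_odd: "\<And>n v. odd n \<Longrightarrow> (v, v) \<notin> parcs G ^^ n"
  shows "bipartite G"
proof -
  have pg: "pair_graph G" and ne: "pverts G \<noteq> {}"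
    using G by (auto simp: connected_graphs_def Digraph_Component.connected_def strongly_connected_def)
  then obtain r where r: "r \<in> pverts G" by auto
  have sym: "(u, v) \<in> parcs G ^^ n \<Longrightarrow> (v, u) \<in> parcs G ^^ n" for u v n
  proof (induction n arbitrary: v)
    case (Suc n)
    from Suc.prems obtain y where y: "(u, y) \<in> parcs G ^^ n" "(y, v) \<in> parcs G" by (rule relpow_Suc_E)
    show ?case using relpow_Suc_I2[OF graph_sym[OF pg y(2)] Suc.IH[OF y(1)]] .
  qed auto
  define A where "A = {v \<in> pverts G. \<exists>n. even n \<and> (r, v) \<in> parcs G ^^ n}"
  define B where "B = {v \<in> pverts G. \<exists>n. odd n \<and> (r, v) \<in> parcs G ^^ n}"
  have "A \<union> B = pverts G"
    using connected_graph_rtrancl[OF G r] by (auto simp: A_def B_def rtrancl_is_UN_relpow)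
  moreover have "A \<inter> B = {}"
  proof -
    have False if "even n" "odd m" "(r, v) \<in> parcs G ^^ n" "(r, v) \<in> parcs G ^^ m" for n m v
    proof -
      have "(r, r) \<in> parcs G ^^ (n + m)" using that sym by (auto simp: relpow_add)
      then show False using no_odd[of "n + m" r] that by auto
    qed
    then show ?thesis by (auto simp: A_def B_def)
  qed
  moreover have "neighbours G A \<subseteq> B" "neighbours G B \<subseteq> A"
  proof -
    have "(\<exists>n. odd n \<and> (r, v) \<in> parcs G ^^ n)" if "even n" "(r, u) \<in> parcs G ^^ n" "(u, v) \<in> parcs G" for u v n
      using relpow_Suc_I[OF that(2,3)] that(1) by (intro exI[of _ "Suc n"]) simp
    then show "neighbours G A \<subseteq> B"
      using graph_verts[OF pg] unfolding A_def B_def neighbours_def by blast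
    have "(\<exists>n. even n \<and> (r, v) \<in> parcs G ^^ n)" if "odd n" "(r, u) \<in> parcs G ^^ n" "(u, v) \<in> parcs G" for u v n
      using relpow_Suc_I[OF that(2,3)] that(1) by (intro exI[of _ "Suc n"]) simp
    then show "neighbours G B \<subseteq> A"
      using graph_verts[OF pg] unfolding A_def B_def neighbours_def by blast
  qed
  ultimately show ?thesis unfolding bipartite_def by blast
qed

text \<open>
  A shortest odd closed walk has neither repetitions nor chords, as either would split off a
  shorter one.
\<close>

lemma odd_closed_walk_imp_embeds_cycle:
  assumes G: "pair_graph G" and walk: "odd n" "(v, v) \<in> parcs G ^^ n"
  shows "\<exists>m\<ge>3. odd m \<and> (\<exists>\<phi>. embeds (cycle_graph m) G \<phi>)"
proof -
  define P where "P = (\<lambda>n. odd n \<and> (\<exists>v. (v, v) \<in> parcs G ^^ n))"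
  define m where "m = (LEAST n. P n)"
  have "P n" using walk by (auto simp: P_def)
  then have m: "P m" and least: "\<And>k. P k \<Longrightarrow> m \<le> k" unfolding m_def by (auto intro: LeastI Least_le)
  then obtain w where om: "odd m" and w: "(w, w) \<in> parcs G ^^ m" by (auto simp: P_def)
  from w obtain c where c: "c 0 = w" "c m = w" "\<And>i. i < m \<Longrightarrow> (c i, c (Suc i)) \<in> parcs G"
    by (auto simp: relpow_fun_conv)
  have seg: "(c i, c (i + k)) \<in> parcs G ^^ k" if "i + k \<le> m" for i k
    unfolding relpow_fun_conv using that c(3) by (intro exI[of _ "\<lambda>j. c (i + j)"]) auto
  have seg': "(c i, c j) \<in> parcs G ^^ (j - i)" if "i \<le> j" "j \<le> m" for i j
    using seg[of i "j - i"] that by simp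
  have around: "(c j, c i) \<in> parcs G ^^ (m - j + i)" if "i \<le> j" "j \<le> m" for i j
  proof -
    have "(c j, w) \<in> parcs G ^^ (m - j)" using seg'[of j m] that c by simp
    moreover have "(w, c i) \<in> parcs G ^^ i" using seg'[of 0 i] that c by simp
    ultimately show ?thesis by (auto simp: relpow_add)
  qed
  have m3: "m \<ge> 3"
  proof (rule ccontr)
    assume "\<not> m \<ge> 3"
    then have "m = 1" using om by (cases m) (auto simp: less_Suc_eq numeral_3_eq_3)
    then show False using w graph_irrefl[OF G] by auto
  qed
  have inj: "c i \<noteq> c j" if ij: "i < j" "j < m" for i j
  proof
    assume eq: "c i = c j"
    \<comment> \<open>The two pieces have lengths adding up to the odd number \<open>m\<close>, so
      one of them is odd.\<close>
    have "odd (j - i) \<or> odd (m - j + i)" using om ij by presburger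
    then have "P (j - i) \<or> P (m - j + i)"
      using seg'[of i j] around[of i j] eq ij by (auto simp: P_def)
    then show False using least[of "j - i"] least[of "m - j + i"] ij by linarith
  qed
  have chord: "j = Suc i \<or> (i = 0 \<and> j = m - 1)" if ij: "i < j" "j < m" and e: "(c i, c j) \<in> parcs G" for i j
  proof -
    have e': "(c j, c i) \<in> parcs G" using graph_sym[OF G e] .
    \<comment> \<open>The chord closes both pieces, with lengths adding up to \<open>m + 2\<close>,
      so one is odd. By minimality it has length at least \<open>m\<close>, which forces the chord
      to be an edge of the cycle.\<close>
    have "odd (Suc (j - i)) \<or> odd (Suc (m - j + i))" using om ij by presburger
    then have "P (Suc (j - i)) \<or> P (Suc (m - j + i))"
      using relpow_Suc_I[OF seg'[of i j] e'] relpow_Suc_I[OF around[of i j] e] ij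
      unfolding P_def by (meson less_imp_le)
    then show ?thesis using least[of "Suc (j - i)"] least[of "Suc (m - j + i)"] ij by linarith
  qed
  have cyc: "(c i, c (Suc i mod m)) \<in> parcs G" if "i < m" for i
    using c(1,2) c(3)[OF that] that by (cases "Suc i = m") auto
  have cv: "c i \<in> pverts G" if "i < m" for i using graph_verts(1)[OF G c(3)[OF that]] .
  have adj: "(c i, c j) \<in> parcs G \<longleftrightarrow> j = Suc i mod m \<or> i = Suc j mod m" if "i < m" "j < m" for i j
  proof
    assume e: "(c i, c j) \<in> parcs G"
    consider "i < j" | "i = j" | "j < i" by linarith
    then show "j = Suc i mod m \<or> i = Suc j mod m"
    proof cases
      case 1
      then show ?thesis using chord[of i j] e that by auto
    next
      case 2
      then show ?thesis using e graph_irrefl[OF G] by auto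
    next
      case 3
      then show ?thesis using chord[of j i] graph_sym[OF G e] that by auto
    qed
  next
    assume "j = Suc i mod m \<or> i = Suc j mod m"
    then show "(c i, c j) \<in> parcs G" using cyc that graph_sym[OF G] by blast
  qed
  have "inj_on c {0..<m}"
    using inj by (intro linorder_inj_onI) auto
  then have "embeds (cycle_graph m) G c"
    using cv adj by (auto simp: embeds_def cycle_graph_def)
  with m3 om show ?thesis by blast
qed

section \<open>Connected graphs with a triangle but no induced pendant graph\<close>

lemma embeds_pendant_graph:
  assumes G: "pair_graph G" and tri: "(a, b) \<in> parcs G" "(a, c) \<in> parcs G" "(b, c) \<in> parcs G"
    and d: "(c, d) \<in> parcs G" "(a, d) \<notin> parcs G" "(b, d) \<notin> parcs G"
  shows "\<exists>\<phi>. embeds pendant_graph G \<phi>"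
proof -
  note sym = graph_sym[OF G] and irr = graph_irrefl[OF G] and vs = graph_verts[OF G]
  have ne: "a \<noteq> b" "a \<noteq> c" "b \<noteq> c" "a \<noteq> d" "b \<noteq> d" "c \<noteq> d"
    using tri d sym irr by blast+
  have adj: "(b, a) \<in> parcs G" "(c, a) \<in> parcs G" "(c, b) \<in> parcs G" "(d, c) \<in> parcs G"
    "(d, a) \<notin> parcs G" "(d, b) \<notin> parcs G"
    using tri d sym by blast+
  have verts: "a \<in> pverts G" "b \<in> pverts G" "c \<in> pverts G" "d \<in> pverts G"
    using tri d vs by blast+
  let ?\<phi> = "(\<lambda>_. a)(2 := b, 3 := c, 4 := d) :: nat \<Rightarrow> 'a"
  have "embeds pendant_graph G ?\<phi>"
    unfolding embeds_def pendant_graph_def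
    by (simp add: ne ne[symmetric] tri d adj verts irr)
  then show ?thesis by blast
qed

text \<open>Membership in a triangle spreads along edges, so every edge lies in a triangle. Then
  every vertex is adjacent to an end of every edge (\<open>dom\<close>), which is transitivity of
  non-adjacency in contrapositive form. The corners of the given triangle lie in three different
  classes.\<close>

lemma separable_if_paw_free:
  assumes G: "G \<in> connected_graphs" and no_paw: "\<not> (\<exists>\<phi>. embeds pendant_graph G \<phi>)"
    and tri: "(a, b) \<in> parcs G" "(a, c) \<in> parcs G" "(b, c) \<in> parcs G"
  shows "\<exists>q\<ge>3. separable G q"
proof -
  have pg: "pair_graph G" using G by (simp add: connected_graphs_def)
  interpret pair_graph G by fact
  note sym = graph_sym[OF pg] and irr = graph_irrefl[OF pg] and vs = graph_verts[OF pg]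
  have paw: "(x, w) \<in> parcs G \<or> (y, w) \<in> parcs G"
    if "(x, y) \<in> parcs G" "(x, z) \<in> parcs G" "(y, z) \<in> parcs G" "(z, w) \<in> parcs G" for x y z w
    using embeds_pendant_graph[OF pg that] no_paw by blast
  define T where "T = {v \<in> pverts G. \<exists>x y. (v, x) \<in> parcs G \<and> (v, y) \<in> parcs G \<and> (x, y) \<in> parcs G}"
  have edge_tri: "\<exists>y. (x, y) \<in> parcs G \<and> (v, y) \<in> parcs G" if v: "v \<in> T" and vx: "(v, x) \<in> parcs G" for v x
  proof -
    from v obtain p q where pq: "(v, p) \<in> parcs G" "(v, q) \<in> parcs G" "(p, q) \<in> parcs G" by (auto simp: T_def)
    have "(p, x) \<in> parcs G \<or> (q, x) \<in> parcs G"
      using paw[OF pq(3) sym[OF pq(1)] sym[OF pq(2)] vx] .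
    then show ?thesis using pq sym by blast
  qed
  have "T = pverts G"
  proof (rule connected_graph_closed_subset[OF G])
    show "T \<noteq> {}" using tri vs by (auto simp: T_def)
    show "T \<subseteq> pverts G" by (auto simp: T_def)
    fix u v assume "u \<in> T" "(u, v) \<in> parcs G"
    then show "v \<in> T" using edge_tri[of u v] sym vs by (auto simp: T_def)
  qed
  then have tri_ex: "\<exists>y. (x, y) \<in> parcs G \<and> (v, y) \<in> parcs G" if "(v, x) \<in> parcs G" for v x
    using edge_tri that vs by blast
  have dom: "(v, x) \<in> parcs G \<or> (v, y) \<in> parcs G" if v: "v \<in> pverts G" and xy: "(x, y) \<in> parcs G" for v x y
  proof -
    let ?Y = "{v \<in> pverts G. (v, x) \<in> parcs G \<or> (v, y) \<in> parcs G}"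
    have "?Y = pverts G"
    proof (rule connected_graph_closed_subset[OF G])
      show "?Y \<noteq> {}" using xy vs by auto
      fix u v assume u: "u \<in> ?Y" and uv: "(u, v) \<in> parcs G"
      \<comment> \<open>With \<open>w\<close> closing the edge \<open>p q\<close> to a triangle,
        adjacency of \<open>v\<close> is passed on through \<open>p q u\<close> if \<open>u\<close>
        is adjacent to \<open>q\<close>, and otherwise through \<open>p w u\<close> and then
        \<open>p q w\<close>.\<close>
      have step: "(v, p) \<in> parcs G \<or> (v, q) \<in> parcs G"
        if up: "(u, p) \<in> parcs G" and pq: "(p, q) \<in> parcs G" for p q
      proof -
        obtain w where w: "(p, w) \<in> parcs G" "(q, w) \<in> parcs G"
          using tri_ex[OF pq] sym by blast
        show ?thesis
        proof (cases "(u, q) \<in> parcs G")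
          case True
          then show ?thesis using paw[of p q u v] up pq uv sym by blast
        next
          case False
          then have uw: "(u, w) \<in> parcs G" using paw[of q w p u] up pq w sym by blast
          then have "(v, p) \<in> parcs G \<or> (v, w) \<in> parcs G" using paw[of p w u v] up w uv sym by blast
          then show ?thesis using paw[of p q w v] pq w sym by blast
        qed
      qed
      have "(v, x) \<in> parcs G \<or> (v, y) \<in> parcs G" using u step[of x y] step[of y x] xy sym by blast
      then show "v \<in> ?Y" using uv vs by blast
    qed auto
    with v show ?thesis by blast
  qed
  define r where "r = {(u, v). u \<in> pverts G \<and> v \<in> pverts G \<and> (u, v) \<notin> parcs G}"
  have eq: "equiv (pverts G) r"
  proof (rule equivI)
    show "refl_on (pverts G) r" using irr by (auto simp: refl_on_def r_def)
    show "sym r" using sym by (auto simp: sym_def r_def)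
    show "trans r" using dom sym unfolding trans_def r_def by blast
  qed (auto simp: r_def)
  let ?P = "pverts G // r"
  have part: "partition_on (pverts G) ?P" by (rule partition_on_quotient[OF eq])
  have cls: "I = r `` {u}" if "I \<in> ?P" "u \<in> I" for I u
    using that eq by (metis Image_singleton_iff equiv_class_eq_iff quotientE)
  have max: "maximal_independent_set G I" if I: "I \<in> ?P" for I
  proof -
    from I obtain u where u: "u \<in> pverts G" "I = r `` {u}" by (auto elim: quotientE)
    have uI: "u \<in> I" using u irr by (auto simp: r_def)
    have sub: "I \<subseteq> pverts G" using u by (auto simp: r_def)
    have "(v, w) \<notin> parcs G" if "v \<in> I" "w \<in> I" for v w
      using that cls[OF I] by (auto simp: r_def)
    then have "independent_set G I" using uI sub by (auto simp: independent_set_def)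
    moreover have "\<not> independent_set G (insert v I)" if "v \<in> pverts G - I" for v
      using that u uI by (auto simp: independent_set_def r_def)
    ultimately show ?thesis by (auto simp: maximal_independent_set_def)
  qed
  have cross: "(u, v) \<in> parcs G" if "I \<in> ?P" "J \<in> ?P" "I \<noteq> J" "u \<in> I" "v \<in> J" for I J u v
  proof (rule ccontr)
    assume "(u, v) \<notin> parcs G"
    moreover have "u \<in> pverts G" "v \<in> pverts G" using that part by (auto simp: partition_on_def)
    ultimately have "v \<in> r `` {u}" by (auto simp: r_def)
    then have "v \<in> I" using cls[OF that(1,4)] by simp
    then show False using cls[OF that(1), of v] cls[OF that(2,5)] that by simp
  qed
  have "card {r `` {a}, r `` {b}, r `` {c}} = 3"
  proof -
    have "r `` {x} \<noteq> r `` {y}" if "(x, y) \<in> parcs G" for x y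
    proof -
      have "y \<in> r `` {y}" "y \<notin> r `` {x}" using that vs irr by (auto simp: r_def)
      then show ?thesis by blast
    qed
    then have "r `` {a} \<noteq> r `` {b}" "r `` {a} \<noteq> r `` {c}" "r `` {b} \<noteq> r `` {c}" using tri by blast+
    then show ?thesis by simp
  qed
  moreover have "{r `` {a}, r `` {b}, r `` {c}} \<subseteq> ?P" using tri vs by (auto intro: quotientI)
  moreover have "finite ?P" using pair_finite_verts by (intro finite_quotient) (auto simp: r_def)
  ultimately have "3 \<le> card ?P" by (metis card_mono)
  then have "3 \<le> card ?P \<and> separable G (card ?P)"
    unfolding separable_def using part max cross by (intro conjI exI[of _ ?P]) auto
  then show ?thesis by blast
qed

section \<open>Unstable cores\<close>

text \<open>Take the distance from \<open>U\<close> and the last vertex but one of a shortest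
  walk.\<close>

lemma distance_function:
  assumes G: "G \<in> connected_graphs" and U: "U \<subseteq> pverts G" "U \<noteq> {}"
  shows "\<exists>d :: 'v \<Rightarrow> nat. \<forall>v\<in>pverts G - U. 0 < d v \<and> (\<exists>u. (v, u) \<in> parcs G \<and> (u \<in> U \<or> d u < d v))"
proof -
  have pg: "pair_graph G" using G by (simp add: connected_graphs_def)
  define R where "R = (\<lambda>n v. \<exists>u\<in>U. (u, v) \<in> parcs G ^^ n)"
  define d where "d = (\<lambda>v. LEAST n. R n v)"
  have R: "R (d v) v" if v: "v \<in> pverts G" for v
  proof -
    obtain u where u: "u \<in> U" using U by auto
    then have "(u, v) \<in> (parcs G)\<^sup>*" using connected_graph_rtrancl[OF G] U v by blast
    then have "\<exists>n. R n v" using u by (auto simp: R_def rtrancl_is_UN_relpow)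
    then show ?thesis unfolding d_def by (rule LeastI_ex)
  qed
  have "0 < d v \<and> (\<exists>u. (v, u) \<in> parcs G \<and> (u \<in> U \<or> d u < d v))" if v: "v \<in> pverts G - U" for v
  proof -
    obtain u where u: "u \<in> U" "(u, v) \<in> parcs G ^^ d v" using R[of v] v by (auto simp: R_def)
    have "d v \<noteq> 0"
    proof
      assume "d v = 0"
      with u have "u = v" by simp
      with u v show False by simp
    qed
    then obtain n where n: "d v = Suc n" by (cases "d v") auto
    with u obtain y where y: "(u, y) \<in> parcs G ^^ n" "(y, v) \<in> parcs G" by (auto elim: relpow_Suc_E)
    have "d y \<le> n" unfolding d_def using u y by (intro Least_le) (auto simp: R_def)
    with n y graph_sym[OF pg y(2)] show ?thesis by (auto intro!: exI[of _ y])
  qed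
  then show ?thesis by blast
qed

text \<open>
  The drift of the \<open>w\<close>-weighted queue length when exactly the classes in \<open>B\<close> have queued items
  and arriving items are matched with available items of least weight.
\<close>

definition greedy_drift :: "'w pair_pre_digraph \<Rightarrow> ('w \<Rightarrow> real) \<Rightarrow> ('w \<Rightarrow> real) \<Rightarrow> 'w set \<Rightarrow> real" where
  "greedy_drift H \<mu> w B = (\<Sum>h\<in>pverts H. \<mu> h *
     (if neighbours H {h} \<inter> B = {} then w h else - Min (w ` (neighbours H {h} \<inter> B))))"

text \<open>One slack \<open>\<eta>\<close> serves all conditions; half of it will absorb the
  classes outside the core, both in \<open>Ncond\<close> and in the drift. The case
  \<open>B = {}\<close> is for the start at the empty queue.\<close>

definition unstable_core :: "'w pair_pre_digraph \<Rightarrow> ('w \<Rightarrow> real) \<Rightarrow> ('w \<Rightarrow> real) \<Rightarrow> real \<Rightarrow> bool" where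
  "unstable_core H \<mu> w \<eta> \<longleftrightarrow> finite (pverts H) \<and> pverts H \<noteq> {} \<and> parcs H \<subseteq> pverts H \<times> pverts H \<and> 0 < \<eta> \<and> \<eta> \<le> 1 \<and>
     (\<forall>h\<in>pverts H. \<eta> \<le> \<mu> h \<and> 0 \<le> w h \<and> w h \<le> 1) \<and>
     (\<forall>I. independent_set H I \<longrightarrow> sum \<mu> I + \<eta> \<le> sum \<mu> (neighbours H I)) \<and>
     (\<forall>B\<subseteq>pverts H. (\<forall>h\<in>B. \<forall>k\<in>B. (h, k) \<notin> parcs H) \<longrightarrow> B = {} \<or> (\<exists>h\<in>B. 0 < w h) \<longrightarrow> \<eta> \<le> greedy_drift H \<mu> w B)"

section \<open>Rates on a graph containing a core\<close>

locale embedded_core =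
  fixes G :: "'v pair_pre_digraph" and H :: "'w pair_pre_digraph" and \<phi> :: "'w \<Rightarrow> 'v"
    and \<mu> w :: "'w \<Rightarrow> real" and \<eta> :: real
  assumes G: "G \<in> connected_graphs" and emb: "embeds H G \<phi>" and core: "unstable_core H \<mu> w \<eta>"
begin

lemma pg: "pair_graph G"
  using G by (simp add: connected_graphs_def)

lemma finite_verts: "finite (pverts G)"
proof -
  interpret pair_graph G by (rule pg)
  show ?thesis by (rule pair_finite_verts)
qed

lemma inj: "inj_on \<phi> (pverts H)" and sub: "\<phi> ` pverts H \<subseteq> pverts G"
  and adj: "\<And>h k. h \<in> pverts H \<Longrightarrow> k \<in> pverts H \<Longrightarrow> (\<phi> h, \<phi> k) \<in> parcs G \<longleftrightarrow> (h, k) \<in> parcs H"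
  using emb unfolding embeds_def by simp_all

lemma core_simps:
  "finite (pverts H)" "pverts H \<noteq> {}" "parcs H \<subseteq> pverts H \<times> pverts H" "0 < \<eta>" "\<eta> \<le> 1"
  "\<And>h. h \<in> pverts H \<Longrightarrow> \<eta> \<le> \<mu> h" "\<And>h. h \<in> pverts H \<Longrightarrow> 0 \<le> w h" "\<And>h. h \<in> pverts H \<Longrightarrow> w h \<le> 1"
  "\<And>I. independent_set H I \<Longrightarrow> sum \<mu> I + \<eta> \<le> sum \<mu> (neighbours H I)"
  "\<And>B. B \<subseteq> pverts H \<Longrightarrow> (\<And>h k. h \<in> B \<Longrightarrow> k \<in> B \<Longrightarrow> (h, k) \<notin> parcs H) \<Longrightarrow> B = {} \<or> (\<exists>h\<in>B. 0 < w h) \<Longrightarrow>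
    \<eta> \<le> greedy_drift H \<mu> w B"
proof -
  have 1: "finite (pverts H)" "pverts H \<noteq> {}" "parcs H \<subseteq> pverts H \<times> pverts H" "0 < \<eta>" "\<eta> \<le> 1"
    and 2: "\<forall>h\<in>pverts H. \<eta> \<le> \<mu> h \<and> 0 \<le> w h \<and> w h \<le> 1"
    and 3: "\<forall>I. independent_set H I \<longrightarrow> sum \<mu> I + \<eta> \<le> sum \<mu> (neighbours H I)"
    and 4: "\<forall>B\<subseteq>pverts H. (\<forall>h\<in>B. \<forall>k\<in>B. (h, k) \<notin> parcs H) \<longrightarrow> B = {} \<or> (\<exists>h\<in>B. 0 < w h) \<longrightarrow>
      \<eta> \<le> greedy_drift H \<mu> w B"
    using core unfolding unstable_core_def by - (elim conjE, assumption)+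
  show "finite (pverts H)" "pverts H \<noteq> {}" "parcs H \<subseteq> pverts H \<times> pverts H" "0 < \<eta>" "\<eta> \<le> 1" by (fact 1)+
  show "\<eta> \<le> \<mu> h" "0 \<le> w h" "w h \<le> 1" if "h \<in> pverts H" for h using 2 that by auto
  show "sum \<mu> I + \<eta> \<le> sum \<mu> (neighbours H I)" if "independent_set H I" for I using 3 that by blast
  show "\<eta> \<le> greedy_drift H \<mu> w B" if "B \<subseteq> pverts H" "\<And>h k. h \<in> B \<Longrightarrow> k \<in> B \<Longrightarrow> (h, k) \<notin> parcs H"
    "B = {} \<or> (\<exists>h\<in>B. 0 < w h)" for B
    using 4[rule_format, OF that(1) _ that(3)] that(2) by blast
qed

definition U :: "'v set" where "U = \<phi> ` pverts H"

definition core_class :: "'v \<Rightarrow> 'w" where "core_class = inv_into (pverts H) \<phi>"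

lemma core_class [simp]: "h \<in> pverts H \<Longrightarrow> core_class (\<phi> h) = h"
  using inj by (simp add: core_class_def)

definition dist_core :: "'v \<Rightarrow> nat" where
  "dist_core = (SOME d. \<forall>v\<in>pverts G - U. 0 < d v \<and> (\<exists>u. (v, u) \<in> parcs G \<and> (u \<in> U \<or> d u < d v)))"

lemma dist_core:
  assumes "v \<in> pverts G - U"
  shows "0 < dist_core v" "\<exists>u. (v, u) \<in> parcs G \<and> (u \<in> U \<or> dist_core u < dist_core v)"
proof -
  have "\<exists>d. \<forall>v\<in>pverts G - U. 0 < d v \<and> (\<exists>u. (v, u) \<in> parcs G \<and> (u \<in> U \<or> d u < (d v :: nat)))"
    by (rule distance_function[OF G]) (use sub core_simps(2) in \<open>auto simp: U_def\<close>)
  from someI_ex[OF this] show "0 < dist_core v"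
    "\<exists>u. (v, u) \<in> parcs G \<and> (u \<in> U \<or> dist_core u < dist_core v)"
    using assms unfolding dist_core_def[symmetric] by auto
qed

text \<open>Small enough that all classes together at rate \<open>eps\<close> have total rate
  \<open>\<eta> / 2\<close>, and that one factor \<open>eps\<close> outweighs the number of
  classes.\<close>

definition eps :: real where "eps = \<eta> / (2 * card (pverts G))"

lemma eps: "0 < eps" "eps \<le> 1" "card (pverts G) * eps = \<eta> / 2"
proof -
  have "0 < card (pverts G)" using finite_verts sub core_simps(2) by (auto simp: card_gt_0_iff)
  then show "0 < eps" "card (pverts G) * eps = \<eta> / 2" "eps \<le> 1"
    using core_simps(4,5) by (auto simp: eps_def field_simps)
qed

text \<open>
  With geometric decay, the class of an independent set that is nearest to the core has a neighbour
  whose rate exceeds the total rate of the set.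
\<close>

definition rate :: "'v \<Rightarrow> real" where
  "rate = (\<lambda>v\<in>pverts G. if v \<in> U then \<mu> (core_class v) else eps ^ dist_core v)"

lemma rate_core [simp]: "h \<in> pverts H \<Longrightarrow> rate (\<phi> h) = \<mu> h"
  using sub by (auto simp: rate_def U_def)

lemma rate_pos: "v \<in> pverts G \<Longrightarrow> 0 < rate v"
proof -
  assume v: "v \<in> pverts G"
  have "0 < \<mu> h" if "h \<in> pverts H" for h using core_simps(4) core_simps(6)[OF that] by simp
  then show ?thesis using v eps(1) by (auto simp: rate_def U_def)
qed

lemma sum_outside: "I \<subseteq> pverts G - U \<Longrightarrow> sum rate I \<le> \<eta> / 2"
proof -
  assume I: "I \<subseteq> pverts G - U"
  have "rate v \<le> eps" if "v \<in> I" for v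
    using that I dist_core(1)[of v] eps power_decreasing[of 1 "dist_core v" eps] by (auto simp: rate_def)
  then have "sum rate I \<le> card I * eps" by (rule sum_bounded_above)
  also have "\<dots> \<le> card (pverts G) * eps"
    using I finite_verts eps by (intro mult_right_mono) (auto intro: card_mono)
  finally show ?thesis using eps by simp
qed

text \<open>A set that avoids the core is handled by the decay of the rates. Otherwise the core part
  has slack \<open>\<eta>\<close>, and the rest of the set has total rate at most
  \<open>\<eta> / 2\<close>.\<close>

lemma rate_Ncond: "rate \<in> Ncond G"
proof -
  have "sum rate I < sum rate (neighbours G I)" if I: "independent_set G I" for I
  proof -
    have IV: "I \<subseteq> pverts G" "I \<noteq> {}" and ind: "\<And>u v. u \<in> I \<Longrightarrow> v \<in> I \<Longrightarrow> (u, v) \<notin> parcs G"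
      using I by (auto simp: independent_set_def)
    have NV: "neighbours G I \<subseteq> pverts G" using graph_verts[OF pg] by (auto simp: neighbours_def)
    have finI: "finite I" and finN: "finite (neighbours G I)"
      using IV NV finite_verts by (auto intro: finite_subset)
    show ?thesis
    proof (cases "I \<inter> U = {}")
      case True
      obtain u where u: "u \<in> I" "\<And>v. v \<in> I \<Longrightarrow> dist_core u \<le> dist_core v"
        using arg_min_if_finite[OF finI IV(2), of dist_core] by (meson not_le)
      have uV: "u \<in> pverts G - U" using u IV True by auto
      obtain u' where u': "(u, u') \<in> parcs G" "u' \<in> U \<or> dist_core u' < dist_core u"
        using dist_core(2)[OF uV] by blast
      have u'V: "u' \<in> pverts G" using graph_verts[OF pg u'(1)] by simp
      have "sum rate I < rate u'"
      proof (cases "u' \<in> U")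
        case True
        have "sum rate I \<le> \<eta> / 2" using IV \<open>I \<inter> U = {}\<close> by (intro sum_outside) auto
        also have "\<dots> < \<eta>" using core_simps(4) by simp
        also have "\<eta> \<le> rate u'" using True core_simps(6) by (auto simp: U_def)
        finally show ?thesis .
      next
        case False
        have "rate v \<le> eps ^ dist_core u" if "v \<in> I" for v
          using that True IV u(2)[OF that] eps power_decreasing[of "dist_core u" "dist_core v" eps]
          by (auto simp: rate_def)
        then have "sum rate I \<le> card I * eps ^ dist_core u" by (rule sum_bounded_above)
        also have "\<dots> \<le> card (pverts G) * eps ^ dist_core u"
          using IV finite_verts eps by (intro mult_right_mono) (auto intro: card_mono)
        \<comment> \<open>The neighbour \<open>u'\<close> is strictly nearer, so one spare factor
          \<open>eps\<close> cancels the cardinality.\<close>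
        also have "\<dots> \<le> card (pverts G) * eps ^ Suc (dist_core u')"
          using False u'(2) eps by (intro mult_left_mono power_decreasing) auto
        also have "\<dots> = \<eta> / 2 * eps ^ dist_core u'" by (simp add: eps(3)[symmetric])
        also have "\<dots> < 1 * eps ^ dist_core u'" using core_simps(5) eps(1) by (intro mult_strict_right_mono) auto
        also have "\<dots> = rate u'" using False u'V by (simp add: rate_def)
        finally show ?thesis .
      qed
      also have "rate u' = sum rate {u'}" by simp
      also have "\<dots> \<le> sum rate (neighbours G I)"
        using u' u finN NV rate_pos by (intro sum_mono2) (auto simp: neighbours_def intro: less_imp_le)
      finally show ?thesis .
    next
      case False
      define J where "J = {h \<in> pverts H. \<phi> h \<in> I}"
      have J: "\<phi> ` J = I \<inter> U" by (auto simp: J_def U_def)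
      have JH: "J \<subseteq> pverts H" by (auto simp: J_def)
      have "independent_set H J"
        unfolding independent_set_def
      proof (intro conjI ballI)
        show "J \<noteq> {}" using False J by blast
        show "(h, k) \<notin> parcs H" if "h \<in> J" "k \<in> J" for h k
          using ind[of "\<phi> h" "\<phi> k"] adj[of h k] that by (auto simp: J_def)
      qed (rule JH)
      then have "sum \<mu> J + \<eta> \<le> sum \<mu> (neighbours H J)" by (rule core_simps(9))
      moreover have NH: "neighbours H J \<subseteq> pverts H" using core_simps(3) by (auto simp: neighbours_def)
      have tr: "sum rate (\<phi> ` K) = sum \<mu> K" if "K \<subseteq> pverts H" for K
        using that inj by (subst sum.reindex) (auto intro: inj_on_subset intro!: sum.cong)
      have "sum rate I = sum rate (I \<inter> U) + sum rate (I - U)"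
        using finI by (metis sum.Int_Diff)
      moreover have "sum rate (I - U) \<le> \<eta> / 2" using IV by (intro sum_outside) auto
      moreover have "sum rate (I \<inter> U) = sum \<mu> J" using tr[OF JH] J by simp
      moreover have "sum \<mu> (neighbours H J) = sum rate (\<phi> ` neighbours H J)" using tr[OF NH] by simp
      moreover have "sum rate (\<phi> ` neighbours H J) \<le> sum rate (neighbours G I)"
      proof (rule sum_mono2[OF finN])
        show "\<phi> ` neighbours H J \<subseteq> neighbours G I"
          using adj NH JH by (fastforce simp: neighbours_def J_def)
        show "0 \<le> rate b" if "b \<in> neighbours G I - \<phi> ` neighbours H J" for b
          using that NV rate_pos by (auto intro: less_imp_le)
      qed
      ultimately show ?thesis using core_simps(4) by linarith
    qed
  qed
  moreover have "rate \<in> pverts G \<rightarrow>\<^sub>E {0<..}"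
    using rate_pos by (auto simp: rate_def)
  ultimately show ?thesis by (simp add: Ncond_def)
qed

section \<open>Potential and drift under the greedy policy\<close>

text \<open>With weight \<open>-1\<close>, items outside the core are matched first, and each such
  match raises the potential by 1, the largest possible jump. Their presence in the queue can
  therefore only improve the contribution of core arrivals to the drift.\<close>

definition weight :: "'v \<Rightarrow> real" where
  "weight v = (if v \<in> U then w (core_class v) else - 1)"

lemma weight_core [simp]: "h \<in> pverts H \<Longrightarrow> weight (\<phi> h) = w h"
  by (auto simp: weight_def U_def)

lemma weight_bounds: "- 1 \<le> weight v" "weight v \<le> 1"
proof -
  have "- 1 \<le> w h \<and> w h \<le> 1" if "h \<in> pverts H" for h
    using core_simps(7,8)[OF that] by simp
  then show "- 1 \<le> weight v" "weight v \<le> 1" by (auto simp: weight_def U_def)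
qed

definition greedy :: "('v \<Rightarrow> nat) \<Rightarrow> 'v \<Rightarrow> 'v" where
  "greedy z i = arg_min_on weight (available G z i)"

lemma finite_available: "finite (available G z i)"
  using graph_verts(2)[OF pg] by (intro finite_subset[OF _ finite_verts]) (auto simp: available_def neighbours_def)

lemma greedy:
  assumes "available G z i \<noteq> {}"
  shows "greedy z i \<in> available G z i" "k \<in> available G z i \<Longrightarrow> weight (greedy z i) \<le> weight k"
  unfolding greedy_def using arg_min_if_finite(1)[OF finite_available assms]
    arg_min_least[OF finite_available assms] by auto

lemma greedy_admissible: "admissible G (\<lambda>z i. return_pmf (greedy z i))"
  using greedy(1) by (auto simp: admissible_def)

definition potential :: "('v \<Rightarrow> nat) \<Rightarrow> real" where
  "potential z = (\<Sum>v\<in>pverts G. weight v * real (z v))"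

definition jump :: "('v \<Rightarrow> nat) \<Rightarrow> 'v \<Rightarrow> real" where
  "jump z i = (if available G z i = {} then weight i else - weight (greedy z i))"

lemma potential_arrive:
  assumes i: "i \<in> pverts G"
  shows "potential (arrive G z i (greedy z i)) = potential z + jump z i"
proof -
  have upd: "potential (z(v := n)) = potential z + weight v * (real n - real (z v))" if "v \<in> pverts G" for v n
  proof -
    have split: "potential y = weight v * y v + (\<Sum>u\<in>pverts G - {v}. weight u * real (y u))" for y
      unfolding potential_def by (rule sum.remove[OF finite_verts that])
    have "(\<Sum>u\<in>pverts G - {v}. weight u * real ((z(v := n)) u)) = (\<Sum>u\<in>pverts G - {v}. weight u * real (z u))"
      by (rule sum.cong) auto
    then show ?thesis using split[of z] split[of "z(v := n)"] by (simp add: algebra_simps)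
  qed
  show ?thesis
  proof (cases "available G z i = {}")
    case True
    then show ?thesis using upd[OF i] by (simp add: arrive_def jump_def)
  next
    case False
    have g: "greedy z i \<in> pverts G" "0 < z (greedy z i)"
      using greedy(1)[OF False] graph_verts[OF pg] by (auto simp: available_def neighbours_def)
    then show ?thesis using upd[OF g(1)] False by (simp add: arrive_def jump_def)
  qed
qed

lemma jump_bounds: "- 1 \<le> jump z i" "jump z i \<le> 1"
  using weight_bounds[of i] weight_bounds[of "greedy z i"] by (auto simp: jump_def)

text \<open>For arrivals in the core, each jump is at least its counterpart in
  \<open>greedy_drift\<close> for the set \<open>B\<close> of nonempty core queues. Arrivals outside
  cost at most 1 each, at total rate at most \<open>\<eta> / 2\<close>.\<close>

lemma drift_ge:
  assumes z: "z \<in> queue_states G" and pos: "(\<forall>v\<in>U. z v = 0) \<or> 0 < potential z"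
  shows "\<eta> / 2 \<le> (\<Sum>i\<in>pverts G. rate i * jump z i)"
proof -
  define B where "B = {h \<in> pverts H. 0 < z (\<phi> h)}"
  have BH: "B \<subseteq> pverts H" by (auto simp: B_def)
  have "(h, k) \<notin> parcs H" if "h \<in> B" "k \<in> B" for h k
    using z that adj[of h k] by (auto simp: B_def queue_states_def)
  moreover have "B = {} \<or> (\<exists>h\<in>B. 0 < w h)"
    using pos
  proof
    assume "0 < potential z"
    \<comment> \<open>A positive potential needs a queued class of positive weight, and such a class
      lies in the core.\<close>
    then have "\<exists>v\<in>pverts G. 0 < weight v * real (z v)"
      unfolding potential_def by (meson not_le sum_nonpos)
    then obtain v where v: "v \<in> pverts G" "0 < weight v" "0 < z v"
      using weight_bounds by (auto simp: zero_less_mult_iff)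
    then have "v \<in> U" by (auto simp: weight_def split: if_splits)
    then show ?thesis using v by (auto simp: B_def U_def)
  qed (auto simp: B_def U_def)
  ultimately have "\<eta> \<le> greedy_drift H \<mu> w B" using BH by (intro core_simps(10)) auto
  also have "\<dots> \<le> (\<Sum>h\<in>pverts H. rate (\<phi> h) * jump z (\<phi> h))"
    unfolding greedy_drift_def
  proof (rule sum_mono)
    fix h assume h: "h \<in> pverts H"
    have "(if neighbours H {h} \<inter> B = {} then w h else - Min (w ` (neighbours H {h} \<inter> B))) \<le> jump z (\<phi> h)" (is "?L \<le> _")
    proof -
      have av: "k \<in> neighbours H {h} \<inter> B \<longleftrightarrow> \<phi> k \<in> available G z (\<phi> h)" if "k \<in> pverts H" for k
        using adj[OF h that] that by (auto simp: available_def neighbours_def B_def)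
      have finB: "finite (neighbours H {h} \<inter> B)" using BH core_simps(1) by (auto intro: finite_subset)
      show ?thesis
      proof (cases "available G z (\<phi> h) = {}")
        case True
        then have "neighbours H {h} \<inter> B = {}" using av BH by blast
        then show ?thesis using True h by (simp add: jump_def)
      next
        case False
        let ?g = "greedy z (\<phi> h)"
        show ?thesis
        proof (cases "?g \<in> U")
          case True
          then obtain k where k: "k \<in> pverts H" "?g = \<phi> k" by (auto simp: U_def)
          have kN: "k \<in> neighbours H {h} \<inter> B" using av[OF k(1)] greedy(1)[OF False] k by simp
          have "w k \<le> w k'" if "k' \<in> neighbours H {h} \<inter> B" for k'
            using greedy(2)[OF False, of "\<phi> k'"] av[of k'] that BH k by auto
          then have "w k \<le> Min (w ` (neighbours H {h} \<inter> B))" using kN finB by (intro Min.boundedI) auto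
          then show ?thesis using kN False k by (auto simp: jump_def)
        next
          case False': False
          \<comment> \<open>The match has weight \<open>-1\<close>, so the actual jump is 1.\<close>
          have "?L \<le> 1"
          proof (cases "neighbours H {h} \<inter> B = {}")
            case False
            then have "Min (w ` (neighbours H {h} \<inter> B)) \<in> w ` (neighbours H {h} \<inter> B)"
              using finB by (intro Min_in) auto
            then have "0 \<le> Min (w ` (neighbours H {h} \<inter> B))" using core_simps(7) BH by auto
            with False show ?thesis by simp
          qed (use core_simps(8) h in auto)
          then show ?thesis using False False' by (simp add: jump_def weight_def)
        qed
      qed
    qed
    then show "\<mu> h * ?L \<le> rate (\<phi> h) * jump z (\<phi> h)"
      using h core_simps(4) core_simps(6)[OF h] by (auto intro: mult_left_mono)
  qed
  also have "\<dots> = (\<Sum>i\<in>U. rate i * jump z i)"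
    unfolding U_def using inj by (subst sum.reindex) auto
  finally have "\<eta> \<le> (\<Sum>i\<in>U. rate i * jump z i)" .
  moreover have "(\<Sum>i\<in>pverts G - U. rate i * (- 1)) \<le> (\<Sum>i\<in>pverts G - U. rate i * jump z i)"
    using rate_pos jump_bounds by (intro sum_mono mult_left_mono) (auto intro: less_imp_le)
  moreover have "- (\<eta> / 2) \<le> (\<Sum>i\<in>pverts G - U. rate i * (- 1))"
    using sum_outside[of "pverts G - U"] by (simp add: sum_negf)
  moreover have "(\<Sum>i\<in>pverts G. rate i * jump z i) =
      (\<Sum>i\<in>pverts G - U. rate i * jump z i) + (\<Sum>i\<in>U. rate i * jump z i)"
    using sub finite_verts by (intro sum.subset_diff) (auto simp: U_def)
  ultimately show ?thesis by linarith
qed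

lemma greedy_not_stable: "\<not> stable G rate (\<lambda>z i. return_pmf (greedy z i))"
proof (rule not_stable[where f=potential])
  show "potential (\<lambda>_. 0) = 0" by (simp add: potential_def)
  have drift: "(\<Sum>i\<in>pverts G. rate i * potential (arrive G z i (greedy z i))) =
      (\<Sum>i\<in>pverts G. rate i * potential z) + (\<Sum>i\<in>pverts G. rate i * jump z i)" for z
    unfolding sum.distrib[symmetric] by (rule sum.cong) (simp_all add: potential_arrive algebra_simps)
  show "(\<Sum>i\<in>pverts G. rate i * potential z) \<le> (\<Sum>i\<in>pverts G. rate i * potential (arrive G z i (greedy z i)))"
    if "z \<in> queue_states G" "0 < potential z" for z
    using drift_ge[of z] that core_simps(4) unfolding drift by auto
  have "(\<lambda>_. 0) \<in> queue_states G" by (auto simp: queue_states_def)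
  from drift_ge[OF this] core_simps(4)
  show "0 < (\<Sum>i\<in>pverts G. rate i * potential (arrive G (\<lambda>_. 0) i (greedy (\<lambda>_. 0) i)))"
    unfolding drift by (auto simp: potential_def)
qed (auto simp: pg rate_pos greedy_admissible potential_arrive jump_bounds)

end

lemma embedded_core_imp_not_matching_stable:
  assumes "embeds H G \<phi>" "unstable_core H \<mu> w \<eta>"
  shows "\<not> matching_stable G"
proof
  assume ms: "matching_stable G"
  then interpret embedded_core G H \<phi> \<mu> w \<eta> using assms by unfold_locales (auto simp: matching_stable_def)
  have "maximal_policy G (\<lambda>z i. return_pmf (greedy z i))"
    using ms greedy_admissible by (auto simp: matching_stable_def)
  then show False
    using rate_Ncond greedy_not_stable by (auto simp: maximal_policy_def stability_region_def)
qed

section \<open>Verification of the two cores\<close>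

text \<open>The double \<open>insert\<close> stops the rule from rewriting singletons, on which it
  would loop.\<close>

lemma neighbours_insert_insert: "neighbours G (insert a (insert b A)) = neighbours G {a} \<union> neighbours G (insert b A)"
  by (auto simp: neighbours_def)

text \<open>Once the membership of each vertex in \<open>B\<close> is decided, these rules evaluate
  the comprehension equal to \<open>B\<close> to an explicit set.\<close>

lemma Collect_insert_if: "{x \<in> insert a A. P x} = (if P a then insert a {x \<in> A. P x} else {x \<in> A. P x})"
  and Collect_empty_if: "{x \<in> {}. P x} = {}"
  by auto

text \<open>With the empty set split off, one enumeration of independent sets settles both the rate
  inequalities and the drift.\<close>

lemma unstable_coreI:
  assumes "finite (pverts H)" "pverts H \<noteq> {}" "parcs H \<subseteq> pverts H \<times> pverts H" "0 < \<eta>" "\<eta> \<le> 1"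
    and "\<forall>h\<in>pverts H. \<eta> \<le> \<mu> h \<and> 0 \<le> w h \<and> w h \<le> 1"
    and empty: "\<eta> \<le> (\<Sum>h\<in>pverts H. \<mu> h * w h)"
    and indep: "\<And>B. independent_set H B \<Longrightarrow>
      sum \<mu> B + \<eta> \<le> sum \<mu> (neighbours H B) \<and> ((\<exists>h\<in>B. 0 < w h) \<longrightarrow> \<eta> \<le> greedy_drift H \<mu> w B)"
  shows "unstable_core H \<mu> w \<eta>"
proof -
  have "\<eta> \<le> greedy_drift H \<mu> w B" if "B \<subseteq> pverts H" "\<forall>h\<in>B. \<forall>k\<in>B. (h, k) \<notin> parcs H" "B = {} \<or> (\<exists>h\<in>B. 0 < w h)" for B
  proof (cases "B = {}")
    case True
    then show ?thesis using empty by (simp add: greedy_drift_def)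
  next
    case False
    then show ?thesis using that indep[of B] by (simp add: independent_set_def)
  qed
  with assms show ?thesis unfolding unstable_core_def by blast
qed

lemma pverts_pendant_graph: "pverts pendant_graph = {1, 2, 3, 4}"
  by (simp add: pendant_graph_def)

lemma neighbours_pendant_graph:
  "neighbours pendant_graph {1} = {2, 3}" "neighbours pendant_graph {2} = {1, 3}"
  "neighbours pendant_graph {3} = {1, 2, 4}" "neighbours pendant_graph {4} = {3}"
  by (auto simp: neighbours_def pendant_graph_def)

definition pendant_rate :: "nat \<Rightarrow> real" where
  "pendant_rate = (\<lambda>_. 1)(4 := 1/2)"

definition pendant_weight :: "nat \<Rightarrow> real" where
  "pendant_weight = (\<lambda>_. 3/8)(3 := 0, 4 := 1)"

text \<open>
  Where the rates come from: suppose a class-3 item is matched with class 4 only if classes 1 and 2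
  are not available. While queue 4 is nonempty, the difference of queues 1 and 2 is a random walk
  which vanishes one third of the time, so class 4 is served at rate \<open>1/3\<close> but arrives at rate
  \<open>1/2\<close>. The weight \<open>3/8\<close> may be any number strictly between \<open>1/4\<close> and \<open>1/2\<close>.
\<close>

lemma unstable_core_pendant_graph:
  "unstable_core pendant_graph pendant_rate pendant_weight (1/8)"
\<comment> \<open>The slack \<open>1/8\<close> is the exact drift for \<open>{1}\<close> and
  \<open>{1, 4}\<close>, and by symmetry for \<open>{2}\<close> and \<open>{2, 4}\<close>.\<close>
proof (rule unstable_coreI)
  fix B assume "independent_set pendant_graph B"
  then have ne: "B \<noteq> {}" and sub: "B \<subseteq> {1, 2, 3, 4}" and ind: "\<forall>h\<in>B. \<forall>k\<in>B. (h, k) \<notin> parcs pendant_graph"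
    unfolding independent_set_def pverts_pendant_graph by blast+
  have "\<not> (1 \<in> B \<and> 2 \<in> B)" "\<not> (1 \<in> B \<and> 3 \<in> B)" "\<not> (2 \<in> B \<and> 3 \<in> B)" "\<not> (3 \<in> B \<and> 4 \<in> B)"
    using ind by (force simp: pendant_graph_def)+
  moreover have "1 \<in> B \<or> 2 \<in> B \<or> 3 \<in> B \<or> 4 \<in> B" using ne sub by blast
  moreover have "{x \<in> {1, 2, 3, 4}. x \<in> B} = B" using sub by blast
  ultimately have "B \<in> {{1}, {2}, {3}, {4}, {1, 4}, {2, 4}}"
    by (cases "1 \<in> B"; cases "2 \<in> B"; cases "3 \<in> B"; cases "4 \<in> B")
      (simp_all only: Collect_insert_if Collect_empty_if if_True if_False simp_thms, simp_all)
  then show "sum pendant_rate B + 1/8 \<le> sum pendant_rate (neighbours pendant_graph B) \<and>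
    ((\<exists>h\<in>B. 0 < pendant_weight h) \<longrightarrow>
      1/8 \<le> greedy_drift pendant_graph pendant_rate pendant_weight B)"
    unfolding greedy_drift_def
    by (elim insertE emptyE)
      (simp_all add: neighbours_pendant_graph pverts_pendant_graph neighbours_insert_insert sum.insert_if pendant_rate_def pendant_weight_def del: One_nat_def)
qed (auto simp: pendant_graph_def pendant_rate_def pendant_weight_def)

lemma parcs_cycle_graph_5:
  "parcs (cycle_graph 5) = {(0, 1), (1, 0), (1, 2), (2, 1), (2, 3), (3, 2), (3, 4), (4, 3), (4, 0), (0, 4)}" (is "_ = ?E")
proof -
  have 1: "\<forall>i\<in>{0, 1, 2, 3, 4 :: nat}. \<forall>j\<in>{0, 1, 2, 3, 4}. (j = Suc i mod 5 \<or> i = Suc j mod 5) \<longleftrightarrow> (i, j) \<in> ?E"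
    by simp
  have lt: "i < 5 \<longleftrightarrow> i \<in> {0, 1, 2, 3, 4}" for i :: nat by auto
  have "(i, j) \<in> parcs (cycle_graph 5) \<longleftrightarrow> (i, j) \<in> ?E" for i j
  proof -
    have *: "(i, j) \<in> parcs (cycle_graph 5) \<longleftrightarrow>
        i \<in> {0, 1, 2, 3, 4} \<and> j \<in> {0, 1, 2, 3, 4} \<and> (j = Suc i mod 5 \<or> i = Suc j mod 5)"
      unfolding cycle_graph_def lt by simp
    show ?thesis
    proof (cases "i \<in> {0, 1, 2, 3, 4} \<and> j \<in> {0, 1, 2, 3, 4}")
      case True
      then have ij: "i \<in> {0, 1, 2, 3, 4}" "j \<in> {0, 1, 2, 3, 4}" by - (elim conjE, assumption)+
      show ?thesis unfolding * 1[THEN bspec, OF ij(1), THEN bspec, OF ij(2)]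
        by (simp only: ij simp_thms)
    next
      case False
      then show ?thesis unfolding * by auto
    qed
  qed
  from this[of "fst p" "snd p" for p] show ?thesis unfolding prod.collapse by (rule set_eqI)
qed

lemma pverts_cycle_graph_5: "pverts (cycle_graph 5) = {0, 1, 2, 3, 4}"
  by (auto simp: cycle_graph_def)

lemma neighbours_cycle_graph_5:
  "neighbours (cycle_graph 5) {0} = {1, 4}" "neighbours (cycle_graph 5) {1} = {0, 2}"
  "neighbours (cycle_graph 5) {2} = {1, 3}" "neighbours (cycle_graph 5) {3} = {2, 4}"
  "neighbours (cycle_graph 5) {4} = {0, 3}"
  by (auto simp: neighbours_def parcs_cycle_graph_5)

text \<open>While queue 0 is nonempty, the difference of queues 2 and 3 moves outwards at rate 2 and
  inwards at rate 3, hence vanishes one fifth of the time. So class 0 is served at rate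
  \<open>1 + 1/5\<close>, below its arrival rate \<open>3/2\<close>.\<close>

definition cycle_rate :: "nat \<Rightarrow> real" where
  "cycle_rate = (\<lambda>_. 1)(0 := 3/2, 2 := 2, 3 := 2)"

text \<open>With weight \<open>a\<close> for classes 2 and 3, the drift is
  \<open>4 * a - 1/2\<close> for \<open>{0}\<close> and \<open>1/2 - a\<close> for
  \<open>{0, 2}\<close> and \<open>{0, 3}\<close>; it is positive for \<open>a\<close> strictly
  between \<open>1/8\<close> and \<open>1/2\<close>.\<close>

definition cycle_weight :: "nat \<Rightarrow> real" where
  "cycle_weight = (\<lambda>_. 0)(0 := 1, 2 := 1/4, 3 := 1/4)"

text \<open>
  The same mechanism: classes 1 and 4, the only ones that serve class 0, prefer 2 and 3, and the
  difference of queues 2 and 3 is a random walk.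
\<close>

lemma unstable_core_cycle_graph_5:
  "unstable_core (cycle_graph 5) cycle_rate cycle_weight (1/8)"
proof (rule unstable_coreI)
  fix B assume "independent_set (cycle_graph 5) B"
  then have ne: "B \<noteq> {}" and sub: "B \<subseteq> {0, 1, 2, 3, 4}" and ind: "\<forall>h\<in>B. \<forall>k\<in>B. (h, k) \<notin> parcs (cycle_graph 5)"
    unfolding independent_set_def pverts_cycle_graph_5 by blast+
  have "\<not> (0 \<in> B \<and> 1 \<in> B)" "\<not> (1 \<in> B \<and> 2 \<in> B)" "\<not> (2 \<in> B \<and> 3 \<in> B)" "\<not> (3 \<in> B \<and> 4 \<in> B)" "\<not> (0 \<in> B \<and> 4 \<in> B)"
    using ind unfolding parcs_cycle_graph_5 by blast+
  moreover have "0 \<in> B \<or> 1 \<in> B \<or> 2 \<in> B \<or> 3 \<in> B \<or> 4 \<in> B" using ne sub by blast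
  moreover have "{x \<in> {0, 1, 2, 3, 4}. x \<in> B} = B" using sub by blast
  ultimately have "B \<in> {{0}, {1}, {2}, {3}, {4}, {0, 2}, {0, 3}, {1, 3}, {1, 4}, {2, 4}}"
    by (cases "0 \<in> B"; cases "1 \<in> B"; cases "2 \<in> B"; cases "3 \<in> B"; cases "4 \<in> B")
      (simp_all only: Collect_insert_if Collect_empty_if if_True if_False simp_thms, simp_all)
  then show "sum cycle_rate B + 1/8 \<le>
      sum cycle_rate (neighbours (cycle_graph 5) B) \<and>
    ((\<exists>h\<in>B. 0 < cycle_weight h) \<longrightarrow>
      1/8 \<le> greedy_drift (cycle_graph 5) cycle_rate cycle_weight B)"
    unfolding greedy_drift_def pverts_cycle_graph_5
    by (elim insertE emptyE)
      (simp_all add: neighbours_cycle_graph_5 neighbours_insert_insert sum.insert_if cycle_rate_def cycle_weight_def del: One_nat_def)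
qed (auto simp: pverts_cycle_graph_5 parcs_cycle_graph_5 cycle_rate_def cycle_weight_def)

theorem theorem3:
  fixes G :: "'v pair_pre_digraph"
  assumes "G \<in> G7c"
    and "matching_stable G"
  shows "\<exists>q\<ge>3. separable G q"
proof -
  have G: "G \<in> connected_graphs" and nG7: "G \<notin> G7" using assms(1) by (auto simp: G7c_def)
  have pg: "pair_graph G" and ne: "pverts G \<noteq> {}"
    using G by (auto simp: connected_graphs_def Digraph_Component.connected_def strongly_connected_def)
  have no_paw: "\<not> (\<exists>\<phi>. embeds pendant_graph G \<phi>)"
    and no_C5: "\<not> (\<exists>\<phi>. embeds (cycle_graph 5) G \<phi>)"
    using embedded_core_imp_not_matching_stable unstable_core_pendant_graph unstable_core_cycle_graph_5 assms(2)
    by blast+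
  have "\<not> bipartite G"
    using bipartite_imp_Ncond_empty[OF pg ne] assms(2) by (auto simp: matching_stable_def)
  then obtain n v where "odd n" "(v, v) \<in> parcs G ^^ n"
    using no_odd_closed_walk_imp_bipartite[OF G] by blast
  then obtain m \<phi> where m: "m \<ge> 3" "odd m" "embeds (cycle_graph m) G \<phi>"
    using odd_closed_walk_imp_embeds_cycle[OF pg] by blast
  \<comment> \<open>Here \<open>G7\<close> enters: a long induced odd cycle outside
    \<open>G7\<close> comes with an induced 5-cycle or pendant graph, and both are already
    excluded.\<close>
  have "\<not> 7 \<le> m"
  proof
    assume "7 \<le> m"
    have "parcs (cycle_graph m) \<subseteq> pverts (cycle_graph m) \<times> pverts (cycle_graph m)"
      by (auto simp: cycle_graph_def)
    then have "induces G (cycle_graph m)" using embeds_imp_induces[OF pg _ m(3)] by blast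
    then have "induces G (cycle_graph 5) \<or> induces G pendant_graph"
      using nG7 G m(2) \<open>7 \<le> m\<close> by (auto simp: G7_def)
    then show False using no_paw no_C5 induces_imp_embeds by blast
  qed
  moreover have "m \<noteq> 5" using m(3) no_C5 by auto
  ultimately have m3: "m = 3" using m(1,2) by presburger
  have "(\<phi> 0, \<phi> 1) \<in> parcs G" "(\<phi> 0, \<phi> 2) \<in> parcs G" "(\<phi> 1, \<phi> 2) \<in> parcs G"
    using m(3) unfolding m3 by (auto simp: embeds_def cycle_graph_def)
  then show ?thesis using separable_if_paw_free[OF G no_paw] by blast
qed

end
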